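(* Let $R$ be a finite commutative local ring with identity and let $k\ge 2$ be an integer. Then: (1) For $k=2$ and $k=3$, $zp_k(R)\notin(\mathcal{B}_k(3;1),\mathcal{B}_k(2;1))$ (open interval), and for $k\ge 4$, $zp_k(R)\notin(\mathcal{B}_k(2;2),\mathcal{B}_k(2;1))$ (open interval). Moreover, $zp_k(R)=\mathcal{B}_k(3;1)$ if and only if $R\cong\mathbb{Z}_3$, and $zp_k(R)=\mathcal{B}_k(2;2)$ if and only if $R\cong\mathbb{Z}_4$ or $R\cong\mathbb{Z}_2*\mathbb{Z}_2$. (2) If $zp_k(R)\ge\mathcal{B}_k(2;3)$, then $R$ is isomorphic to one of the following rings: (i) $\mathbb{Z}_2,\ \mathbb{Z}_3,\ \mathbb{Z}_4,\ \mathbb{Z}_2*\mathbb{Z}_2,\ \mathbb{Z}_4*\mathbb{Z}_2,\ \mathbb{Z}_2*(\mathbb{Z}_2)^2,\ GF(4)$ when $k=2$; (ii) $\mathbb{Z}_2,\ \mathbb{Z}_3,\ \mathbb{Z}_4,\ \mathbb{Z}_2*\mathbb{Z}_2,\ \mathbb{Z}_4*\mathbb{Z}_2,\ \mathbb{Z}_2*(\mathbb{Z}_2)^2$ when $2<k<6$; (iii) $\mathbb{Z}_2,\ \mathbb{Z}_4,\ \mathbb{Z}_2*\mathbb{Z}_2,\ \mathbb{Z}_4*\mathbb{Z}_2,\ \mathbb{Z}_2*(\mathbb{Z}_2)^2$ when $k\ge 6$.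
   Context: For a finite commutative ring $R$ with identity and an integer $k\ge 2$, $zp_k(R)=|\{(x_1,\dots,x_k)\in R^k : x_1x_2\cdots x_k=0\}|/|R|^k$. For a prime $p$ and integers $\alpha>0$, $k\ge 2$, $$\mathcal{B}_k(p;\alpha)=\frac{p^{\alpha-1}\left\{p^k-(k+p-1)(p-1)^{k-1}\right\}+k(p-1)^{k-1}}{p^{k+\alpha-1}}.$$ $\mathbb{Z}_n$ is the ring of integers modulo $n$ and $GF(q)$ is the finite field of order $q$. For a commutative ring $S$ with identity and a unitary $S$-module $M$, $S*M$ denotes Nagata's idealization: the set $S\times M$ with $(r_1,m_1)+(r_2,m_2)=(r_1+r_2,m_1+m_2)$ and $(r_1,m_1)(r_2,m_2)=(r_1r_2,\,r_1m_2+r_2m_1)$. Here $\mathbb{Z}_2$ is regarded as a module over $\mathbb{Z}_4$ in the natural way. *)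

theory Defs
  imports Complex_Main "HOL-Algebra.Algebra" "HOL-Number_Theory.Residues"
begin

(* The zero ring has no maximal ideal, so it is not local. Fields are local. *)
locale local_ring = cring +
  assumes unique_maximalideal: "\<exists>!M. maximalideal M R"

definition zp :: "nat \<Rightarrow> ('a, 'b) ring_scheme \<Rightarrow> real" where
  "zp k R = real (card {x \<in> {1..k} \<rightarrow>\<^sub>E carrier R. (\<Otimes>\<^bsub>R\<^esub>i\<in>{1..k}. x i) = \<zero>\<^bsub>R\<^esub>})
            / real (card (carrier R)) ^ k"

(* Used for p prime, alpha > 0 and k \<ge> 2, so no exponent is truncated. *)
definition zp_bound :: "nat \<Rightarrow> nat \<Rightarrow> nat \<Rightarrow> real" where
  "zp_bound k p \<alpha> =
     (real p ^ (\<alpha> - 1) * (real p ^ k - (real k + real p - 1) * (real p - 1) ^ (k - 1))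
        + real k * (real p - 1) ^ (k - 1))
     / real p ^ (k + \<alpha> - 1)"

(* Z_n with integers acting by multiplication mod n. This is the natural module structure
   over residue_ring m for every m that n divides. As for every module record, the fields
   mult and one carry no meaning for the module. *)
definition residue_module :: "int \<Rightarrow> (int, int) module" where
  "residue_module n =
     \<lparr>carrier = {0..n - 1},
      monoid.mult = \<lambda>x y. (x * y) mod n,
      monoid.one = 1,
      ring.zero = 0,
      ring.add = \<lambda>x y. (x + y) mod n,
      smult = \<lambda>a x. (a * x) mod n\<rparr>"

definition module_sum :: "('a, 'b) module \<Rightarrow> ('a, 'c) module \<Rightarrow> ('a, 'b \<times> 'c) module" where
  "module_sum M N =
     \<lparr>carrier = carrier M \<times> carrier N,
      monoid.mult = \<lambda>(x, y) (x', y'). (x \<otimes>\<^bsub>M\<^esub> x', y \<otimes>\<^bsub>N\<^esub> y'),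
      monoid.one = (\<one>\<^bsub>M\<^esub>, \<one>\<^bsub>N\<^esub>),
      ring.zero = (\<zero>\<^bsub>M\<^esub>, \<zero>\<^bsub>N\<^esub>),
      ring.add = \<lambda>(x, y) (x', y'). (x \<oplus>\<^bsub>M\<^esub> x', y \<oplus>\<^bsub>N\<^esub> y'),
      smult = \<lambda>a (x, y). (a \<odot>\<^bsub>M\<^esub> x, a \<odot>\<^bsub>N\<^esub> y)\<rparr>"

(* Nagata's idealization S * M *)
definition idealization :: "('a, 'c) ring_scheme \<Rightarrow> ('a, 'b) module \<Rightarrow> ('a \<times> 'b) ring" where
  "idealization S M =
     \<lparr>carrier = carrier S \<times> carrier M,
      monoid.mult = \<lambda>(r, m) (r', m'). (r \<otimes>\<^bsub>S\<^esub> r', (r \<odot>\<^bsub>M\<^esub> m') \<oplus>\<^bsub>M\<^esub> (r' \<odot>\<^bsub>M\<^esub> m)),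
      monoid.one = (\<one>\<^bsub>S\<^esub>, \<zero>\<^bsub>M\<^esub>),
      ring.zero = (\<zero>\<^bsub>S\<^esub>, \<zero>\<^bsub>M\<^esub>),
      ring.add = \<lambda>(r, m) (r', m'). (r \<oplus>\<^bsub>S\<^esub> r', m \<oplus>\<^bsub>M\<^esub> m')\<rparr>"

(* GF(4) = Z_2[w] with w^2 = w + 1; the pair (a, b) stands for a + b w. *)
definition GF4 :: "(int \<times> int) ring" where
  "GF4 =
     \<lparr>carrier = {0..1} \<times> {0..1},
      monoid.mult = \<lambda>(a, b) (c, d). ((a * c + b * d) mod 2, (a * d + b * c + b * d) mod 2),
      monoid.one = (1, 0),
      ring.zero = (0, 0),
      ring.add = \<lambda>(a, b) (c, d). ((a + c) mod 2, (b + d) mod 2)\<rparr>"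

lemma order_GF4: "order GF4 = 4"
  by (simp add: order_def GF4_def)

lemma carrier_GF4: "carrier GF4 = {(0, 0), (0, 1), (1, 0), (1, 1)}"
proof -
  have "{0..1::int} = {0, 1}" by auto
  then show ?thesis by (auto simp: GF4_def)
qed

lemma field_GF4: "field GF4"
proof -
  have "abelian_group GF4"
    by (rule abelian_groupI; simp only: carrier_GF4) (auto simp: GF4_def)
  moreover have "comm_monoid GF4"
    by (rule comm_monoidI; simp only: carrier_GF4) (auto simp: GF4_def)
  ultimately have "cring GF4"
    by (rule cringI; simp only: carrier_GF4) (auto simp: GF4_def)
  then interpret cring GF4 .
  show ?thesis
  proof (rule cring_fieldI2)
    show "\<zero>\<^bsub>GF4\<^esub> \<noteq> \<one>\<^bsub>GF4\<^esub>" by (simp add: GF4_def)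
    fix a assume "a \<in> carrier GF4" "a \<noteq> \<zero>\<^bsub>GF4\<^esub>"
    then show "\<exists>b\<in>carrier GF4. a \<otimes>\<^bsub>GF4\<^esub> b = \<one>\<^bsub>GF4\<^esub>"
      unfolding carrier_GF4 by (auto simp: GF4_def)
  qed
qed

lemma module_residue_module:
  assumes "m > 1" "n > 0" "n dvd m"
  shows "module (residue_ring m) (residue_module n)"
proof -
  interpret residues m "residue_ring m"
    by unfold_locales (use assms in auto)
  have mm: "(a mod m * x) mod n = (a * x) mod n" for a x :: int
    by (metis assms(3) mod_mod_cancel mod_mult_left_eq)
  have "\<exists>y\<in>{0..n - 1}. (y + x) mod n = 0" if "0 \<le> x" "x < n" for x
    by (rule bexI[of _ "(- x) mod n"]) (use assms(2) in \<open>auto simp: mod_add_left_eq\<close>)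
  then have ag: "abelian_group (residue_module n)"
    using assms(2)
    by (intro abelian_groupI) (auto simp: residue_module_def mod_add_left_eq mod_add_right_eq ac_simps)
  have mm': "((a + b) mod m * x) mod n = ((a + b) * x) mod n"
    and mm'': "((a * b) mod m * x) mod n = (a * b * x) mod n" for a b x
    by (simp_all add: mm)
  show ?thesis
    by (rule moduleI[OF is_cring ag])
       (use assms in \<open>auto simp: residue_module_def residue_ring_def mm mod_add_eq
          mod_mult_right_eq distrib_left distrib_right mult.assoc mm' mm''\<close>)
qed

lemma module_module_sum:
  assumes "module R M" "module R N"
  shows "module R (module_sum M N)"
proof -
  interpret M: module R M by fact
  interpret N: module R N by fact
  have "abelian_group (module_sum M N)"
  proof (rule abelian_groupI)
    fix x assume "x \<in> carrier (module_sum M N)"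
    then show "\<exists>y\<in>carrier (module_sum M N). y \<oplus>\<^bsub>module_sum M N\<^esub> x = \<zero>\<^bsub>module_sum M N\<^esub>"
      by (intro bexI[of _ "(\<ominus>\<^bsub>M\<^esub> fst x, \<ominus>\<^bsub>N\<^esub> snd x)"])
         (auto simp: module_sum_def M.M.l_neg N.M.l_neg)
  qed (auto simp: module_sum_def M.M.a_ac N.M.a_ac)
  then show ?thesis
    by (intro moduleI M.R.is_cring)
       (auto simp: module_sum_def M.smult_l_distr N.smult_l_distr M.smult_r_distr N.smult_r_distr
          M.smult_assoc1 N.smult_assoc1)
qed

lemma cring_idealization:
  assumes "module S M"
  shows "cring (idealization S M)"
proof -
  interpret module S M by fact
  have "abelian_group (idealization S M)"
  proof (rule abelian_groupI)
    fix x assume "x \<in> carrier (idealization S M)"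
    then show "\<exists>y\<in>carrier (idealization S M). y \<oplus>\<^bsub>idealization S M\<^esub> x = \<zero>\<^bsub>idealization S M\<^esub>"
      by (intro bexI[of _ "(\<ominus>\<^bsub>S\<^esub> fst x, \<ominus>\<^bsub>M\<^esub> snd x)"])
         (auto simp: idealization_def R.l_neg M.l_neg)
  qed (auto simp: idealization_def R.a_ac M.a_ac)
  moreover have "comm_monoid (idealization S M)"
  proof (rule comm_monoidI)
    fix x y z
    assume "x \<in> carrier (idealization S M)" "y \<in> carrier (idealization S M)"
      "z \<in> carrier (idealization S M)"
    then show "(x \<otimes>\<^bsub>idealization S M\<^esub> y) \<otimes>\<^bsub>idealization S M\<^esub> z
             = x \<otimes>\<^bsub>idealization S M\<^esub> (y \<otimes>\<^bsub>idealization S M\<^esub> z)"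
      by (auto simp: idealization_def R.m_ac M.a_ac smult_r_distr smult_assoc1[symmetric])
  qed (auto simp: idealization_def R.m_ac M.a_ac)
  ultimately show ?thesis
    by (rule cringI)
       (auto simp: idealization_def R.l_distr smult_l_distr smult_r_distr M.a_ac)
qed

end

theory Submission
  imports Defs
begin

text \<open>
  In a finite local ring \<open>R\<close> the nonunits form the maximal ideal \<open>M\<close>. Put \<open>m = |M|\<close> and
  \<open>q = |R/M|\<close>, so that \<open>|R| = q m\<close> and there are \<open>(q - 1) m\<close> units. The value of \<open>zp\<close> is found by counting the
  \<open>k\<close>-tuples whose product is \<^emph>\<open>not\<close> zero, sorted by the number of nonunits among their entries. With no
  nonunit the product is a unit. With exactly one nonunit, the product is zero only if that entry is zero.
  Both kinds can be counted in terms of \<open>q\<close>, \<open>m\<close> and \<open>k\<close> alone. With two or more nonunits the product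
  lies in \<open>M\<^sup>2\<close>, so tuples of this third kind with nonzero product exist (for \<open>k \<ge> 2\<close>) if and only if
  \<open>M\<^sup>2 \<noteq> 0\<close>. Hence \<open>zp k R \<le> max_zp k q m\<close> for an explicit function \<open>max_zp\<close>, with equality exactly
  when \<open>M\<^sup>2 = 0\<close> (\<open>zp_le_max_zp\<close>, \<open>zp_eq_max_zp_iff\<close>), and \<open>zp_bound k p \<alpha>\<close> is the value
  \<open>max_zp k p (p\<^bsup>\<alpha> - 1\<^esup>)\<close>.

  The theorem thus asks which pairs \<open>(q, m)\<close> can reach \<open>zp_bound k 2 3 = max_zp k 2 4\<close>. As \<open>max_zp\<close> decreases
  in \<open>m\<close>, elementary estimates leave \<open>q = 2\<close> with \<open>m \<le> 4\<close>, then \<open>(3, 1)\<close> for \<open>k < 6\<close>, and \<open>(4, 1)\<close>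
  for \<open>k = 2\<close> (\<open>max_zp_small\<close>, \<open>max_zp_3_1_less\<close>). For \<open>q = 2\<close> the element \<open>1 + 1 + 1\<close> is a unit,
  so \<open>R\<close> has no additive 3-torsion and, by Cauchy's theorem, 3 does not divide \<open>|R|\<close>; this rules out \<open>m = 3\<close>.
  It also makes \<open>zp k R\<close> a fraction whose denominator is prime to 3, so that it cannot be \<open>1 - (2/3)\<^bsup>k\<^esup>\<close>,
  the value for \<open>\<int>\<^sub>3\<close>, which for large \<open>k\<close> lies inside the range that the estimates leave open.

  For \<open>(2, 4)\<close> the value \<open>max_zp k 2 4\<close> is reached only if \<open>M\<^sup>2 = 0\<close>, so the remaining rings have order at
  most 8 and a simple structure. Each is identified by mapping the model ring to it: integers go to
  multiples of 1 and the generators of the module go to suitable nonunits (for the field of order 4, a root of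
  \<open>X\<^sup>2 + X + 1\<close> plays their part). Since the orders agree, a trivial kernel
  suffices (\<open>ring_iso_if_trivial_kernel\<close>).
\<close>

section \<open>Comparing the extremal values\<close>

text \<open>
  The proportion of tuples with product zero in a local ring whose maximal ideal has order \<open>m\<close>,
  index \<open>q\<close> and square zero. The two subtracted terms are the proportions of tuples of units and of
  tuples with exactly one nonunit, that entry being nonzero.
\<close>

definition max_zp :: "nat \<Rightarrow> nat \<Rightarrow> nat \<Rightarrow> real" where
  "max_zp k q m =
     1 - ((real q - 1) / real q) ^ k
       - real k * ((real q - 1) / real q) ^ (k - 1) * (real m - 1) / (real q * real m)"

lemma zp_bound_eq_max_zp:
  assumes "p \<ge> 1" "k \<ge> 1"
  shows "zp_bound k p (Suc a) = max_zp k p (p ^ a)"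
proof -
  obtain j where k: "k = Suc j" using assms(2) by (cases k) auto
  have p: "real p \<noteq> 0" using assms(1) by simp
  show ?thesis
    unfolding zp_bound_def max_zp_def k using p
    by (simp add: field_simps power_add)
qed

lemma max_zp_antimono_strict:
  assumes "q \<ge> 2" "k \<ge> 1" "1 \<le> m" "m < m'"
  shows "max_zp k q m' < max_zp k q m"
proof -
  have "1 / real m' < 1 / real m" using assms by (simp add: field_simps)
  then have "(real m - 1) / real m < (real m' - 1) / real m'"
    using assms by (simp add: diff_divide_distrib)
  moreover have "0 < real k * ((real q - 1) / real q) ^ (k - 1) / real q"
    using assms by (intro divide_pos_pos mult_pos_pos zero_less_power) auto
  ultimately have "real k * ((real q - 1) / real q) ^ (k - 1) / real q * ((real m - 1) / real m)
      < real k * ((real q - 1) / real q) ^ (k - 1) / real q * ((real m' - 1) / real m')"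
    by (rule mult_strict_left_mono)
  then show ?thesis unfolding max_zp_def by (simp add: algebra_simps)
qed

lemma max_zp_antimono:
  assumes "q \<ge> 2" "k \<ge> 1" "1 \<le> m" "m \<le> m'"
  shows "max_zp k q m' \<le> max_zp k q m"
  using max_zp_antimono_strict[OF assms(1-3), of m'] assms(4) by (cases "m = m'") auto

lemma max_zp_field: "max_zp k q 1 = 1 - ((real q - 1) / real q) ^ k"
  by (simp add: max_zp_def)

lemma max_zp_2:
  assumes "k \<ge> 1" "m \<ge> 1"
  shows "max_zp k 2 m = 1 - (1 + real k * (1 - 1 / real m)) / 2 ^ k"
proof -
  obtain j where k: "k = Suc j" using assms(1) by (cases k) auto
  show ?thesis using assms(2) unfolding max_zp_def k by (simp add: field_simps)
qed

lemma max_zp_3_2: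
  assumes "k \<ge> 1"
  shows "max_zp k 3 2 = 1 - (1 + real k / 4) * (2/3) ^ k"
proof -
  obtain j where k: "k = Suc j" using assms(1) by (cases k) auto
  show ?thesis unfolding max_zp_def k by (simp add: field_simps)
qed

text \<open>
  All the comparisons below that hold for every large \<open>k\<close> come down to an exponential outgrowing a
  linear function: at the starting point \<open>k0\<close> the increment of the left side is at most that of the right,
  and from there on the gap only widens.
\<close>

lemma power_gt_linear:
  fixes a b c :: real
  assumes "c \<ge> 1" "b \<ge> 0" "a + b * real k0 < c ^ k0" "b \<le> (c - 1) * (a + b * real k0)" "k \<ge> k0"
  shows "a + b * real k < c ^ k"
  using \<open>k \<ge> k0\<close>
proof (induction k rule: dec_induct)
  case (step n)
  have "(c - 1) * (a + b * real k0) \<le> (c - 1) * (a + b * real n)"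
    using assms(1,2) step(1) by (intro mult_left_mono) (auto simp: mult_left_mono)
  then have "a + b * real (Suc n) \<le> c * (a + b * real n)"
    using assms(4) by (simp add: algebra_simps)
  also have "\<dots> < c * c ^ n"
    using step(3) assms(1) by (intro mult_strict_left_mono) auto
  finally show ?case by simp
qed (use assms(3) in simp)

text \<open>
  Since \<open>max_zp k 2 4 = 1 - (1 + 3k/4) / 2\<^bsup>k\<^esup>\<close>, multiplying by \<open>2\<^bsup>k\<^esup>\<close> reduces the comparison with the
  value \<open>1 - t\<^bsup>k\<^esup>\<close> of a field to \<open>power_gt_linear\<close>.
\<close>

lemma less_max_zp_2_4:
  assumes "k \<ge> 1" "1 + 3 / 4 * real k < (2 * t) ^ k"
  shows "1 - t ^ k < max_zp k 2 4"
proof -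
  have "(1 + real k * (1 - 1 / 4)) / 2 ^ k < t ^ k"
    using assms(2) by (simp add: field_simps power_mult_distrib)
  then show ?thesis using max_zp_2[OF assms(1), of 4] by simp
qed

lemma max_zp_3_2_less:
  assumes "k \<ge> 2"
  shows "max_zp k 3 2 < max_zp k 2 4"
proof -
  have "1 + 3 / 4 * real k < (1 + real k / 4) * (4 / 3) ^ k"
  proof (cases "k = 2")
    case True
    then show ?thesis by (simp add: power2_eq_square)
  next
    case False
    then have k: "k \<ge> 3" using assms by simp
    \<comment> \<open>At \<open>k = 3\<close> the line \<open>1 + 9k/20\<close> still runs below \<open>(4/3)\<^bsup>k\<^esup>\<close>, and its product with \<open>1 + k/4\<close> exceeds \<open>1 + 3k/4\<close>.\<close>
    have "1 + 9 / 20 * real k < (4 / 3) ^ k"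
      by (rule power_gt_linear[OF _ _ _ _ k]) (simp_all add: power3_eq_cube)
    then have "(1 + real k / 4) * (1 + 9 / 20 * real k) < (1 + real k / 4) * (4 / 3) ^ k"
      by (intro mult_strict_left_mono) auto
    moreover have "real k * 3 \<le> real k * real k" using k by (intro mult_left_mono) auto
    moreover have "(1 + real k / 4) * (1 + 9 / 20 * real k)
        = 1 + 7 / 10 * real k + 9 / 80 * (real k * real k)"
      by (simp add: field_simps)
    ultimately show ?thesis by linarith
  qed
  moreover have "(4 / 3 :: real) ^ k = 2 ^ k * (2 / 3) ^ k"
    by (simp add: power_mult_distrib[symmetric])
  ultimately have "(1 + real k * (1 - 1 / 4)) / 2 ^ k < (1 + real k / 4) * (2 / 3) ^ k"
    by (simp add: field_simps)
  then show ?thesis using max_zp_2[of k 4] max_zp_3_2[of k] assms by simp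
qed

text \<open>
  For given \<open>q\<close> the value is largest at \<open>m = 1\<close>, the case of a field, and there it decreases in \<open>q\<close>.
\<close>

lemma max_zp_le_field:
  assumes "q \<ge> q0" "q0 \<ge> 2" "k \<ge> 1" "m \<ge> 1"
  shows "max_zp k q m \<le> 1 - ((real q0 - 1) / real q0) ^ k"
proof -
  have "max_zp k q m \<le> 1 - ((real q - 1) / real q) ^ k"
    using max_zp_antimono[of q k 1 m] assms max_zp_field by simp
  moreover have "((real q0 - 1) / real q0) ^ k \<le> ((real q - 1) / real q) ^ k"
    using assms by (intro power_mono) (auto simp: field_simps)
  ultimately show ?thesis by simp
qed

text \<open>
  For these pairs \<open>(q, m)\<close> the value is too small for the classification. The order 6 in the case
  \<open>q = 3\<close>, \<open>m = 2\<close> does not belong to a local ring, but monotonicity in \<open>m\<close> lets it stand for all \<open>m \<ge> 2\<close>.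
\<close>

lemma max_zp_small:
  assumes "k \<ge> 2" "m \<ge> 1" "q = 3 \<and> m \<ge> 2 \<or> q = 4 \<and> (m \<ge> 2 \<or> k \<ge> 3) \<or> q \<ge> 5"
  shows "max_zp k q m < max_zp k 2 4"
proof -
  have k1: "k \<ge> 1" using assms(1) by simp
  consider "q = 3" "m \<ge> 2" | "q = 4" "k \<ge> 3" | "q = 4" "m \<ge> 2" "k = 2" | "q \<ge> 5"
    using assms by linarith
  then show ?thesis
  proof cases
    case 1
    then show ?thesis
      using max_zp_antimono[of 3 k 2 m] max_zp_3_2_less[OF assms(1)] k1 by simp
  next
    case 2
    have "1 + 3 / 4 * real k < (2 * (3 / 4)) ^ k"
      by (rule power_gt_linear[OF _ _ _ _ 2(2)]) (simp_all add: power3_eq_cube)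
    then have "1 - (3 / 4) ^ k < max_zp k 2 4" by (rule less_max_zp_2_4[OF k1])
    then show ?thesis using max_zp_le_field[of 4 q k m] 2 k1 assms(2) by simp
  next
    case 3
    show ?thesis
    proof -
      have "max_zp 2 4 m \<le> max_zp 2 4 2" using 3 by (intro max_zp_antimono) auto
      moreover have "max_zp 2 4 2 < max_zp 2 2 4" by (simp add: max_zp_def power2_eq_square)
      ultimately show ?thesis using 3 by simp
    qed
  next
    case 4
    have "1 + 3 / 4 * real k < (2 * (4 / 5)) ^ k"
      by (rule power_gt_linear[OF _ _ _ _ assms(1)]) (simp_all add: power2_eq_square)
    then have "1 - (4 / 5) ^ k < max_zp k 2 4" by (rule less_max_zp_2_4[OF k1])
    then show ?thesis using max_zp_le_field[of 5 q k m] 4 k1 assms(2) by simp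
  qed
qed

lemma max_zp_3_1_less:
  assumes "k \<ge> 6"
  shows "max_zp k 3 1 < max_zp k 2 4"
proof -
  have "1 + 3 / 4 * real k < (2 * (2 / 3)) ^ k"
    by (rule power_gt_linear[OF _ _ _ _ assms]) (simp_all add: power_divide)
  then have "1 - (2 / 3) ^ k < max_zp k 2 4" using assms by (intro less_max_zp_2_4) auto
  then show ?thesis unfolding max_zp_field by simp
qed

lemma max_zp_3_1_less_2_2:
  assumes "k \<ge> 4"
  shows "max_zp k 3 1 < max_zp k 2 2"
proof -
  have "1 + 1 / 2 * real k < (4 / 3) ^ k"
    by (rule power_gt_linear[OF _ _ _ _ assms]) (simp_all add: power_divide)
  moreover have "(4 / 3 :: real) ^ k = 2 ^ k * (2 / 3) ^ k"
    by (simp add: power_mult_distrib[symmetric])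
  ultimately have "(1 + real k * (1 - 1 / 2)) / 2 ^ k < (2 / 3) ^ k"
    by (simp add: field_simps)
  then show ?thesis using max_zp_2[of k 2] assms max_zp_field[of k 3] by simp
qed

text \<open>
  In lowest terms the first value has denominator \<open>3\<^bsup>k\<^esup>\<close> and the second a power of 2.
\<close>

lemma max_zp_3_1_neq_2_2:
  assumes "k \<ge> 1"
  shows "max_zp k 3 1 \<noteq> max_zp k 2 2"
proof
  assume "max_zp k 3 1 = max_zp k 2 2"
  then have "(2 / 3) ^ k = (1 + real k / 2) / 2 ^ k"
    using max_zp_2[of k 2] assms max_zp_field[of k 3] by simp
  then have "2 * (2 ^ k * 2 ^ k) = (2 + real k) * 3 ^ k"
    by (simp add: field_simps)
  then have "real (2 * (2 ^ k * 2 ^ k)) = real ((2 + k) * 3 ^ k)"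
    by (simp add: algebra_simps)
  then have "2 * (2 ^ k * 2 ^ k) = (2 + k) * 3 ^ k" by (simp only: of_nat_eq_iff)
  then have "3 dvd 2 * (2 ^ k * 2 ^ k :: nat)"
    using assms by (metis dvd_mult dvd_power zero_less_one less_le_trans)
  moreover have "Factorial_Ring.prime (3::nat)" by simp
  ultimately have "(3::nat) dvd 2"
    by (metis prime_dvd_mult_nat prime_dvd_power_nat)
  then show False by simp
qed

lemma max_zp_3_1_less_2_1:
  assumes "k \<ge> 1"
  shows "max_zp k 3 1 < max_zp k 2 1"
proof -
  have "(1 / 2 :: real) ^ k < (2 / 3) ^ k"
    using assms by (intro power_strict_mono) auto
  then show ?thesis unfolding max_zp_field by simp
qed

lemma max_zp_less_3_1:
  assumes "k \<ge> 1" "m \<ge> 1" "q = 3 \<and> m \<ge> 2 \<or> q \<ge> 4"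
  shows "max_zp k q m < max_zp k 3 1"
  using assms(3)
proof
  assume "q = 3 \<and> m \<ge> 2"
  then show ?thesis using max_zp_antimono_strict[of 3 k 1 m] assms(1) by simp
next
  assume "q \<ge> 4"
  then have "max_zp k q m \<le> 1 - (3 / 4) ^ k"
    using max_zp_le_field[of 4 q k m] assms(1,2) by simp
  also have "(2 / 3 :: real) ^ k < (3 / 4) ^ k"
    using assms(1) by (intro power_strict_mono) auto
  then have "1 - (3 / 4) ^ k < max_zp k 3 1" unfolding max_zp_field by simp
  finally show ?thesis .
qed

lemma max_zp_2_2_le_3_1:
  assumes "k = 2 \<or> k = 3"
  shows "max_zp k 2 2 \<le> max_zp k 3 1"
  using assms by (auto simp: max_zp_def power2_eq_square power3_eq_cube)

section \<open>The maximal ideal of a finite local ring\<close>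

locale finite_local_ring = local_ring +
  assumes finite_carrier: "finite (carrier R)"
begin

abbreviation nonunits :: "'a set" where
  "nonunits \<equiv> carrier R - Units R"

text \<open>
  A nonunit generates a proper ideal. By finiteness a maximal one among the proper ideals containing it exists,
  and this must be the unique maximal ideal.
\<close>

lemma nonunits_is_maximal: "maximalideal nonunits R"
proof -
  obtain M where M: "maximalideal M R" and unique: "\<And>J. maximalideal J R \<Longrightarrow> J = M"
    using unique_maximalideal by blast
  interpret M: maximalideal M R by fact
  have "M \<subseteq> nonunits"
  proof
    fix x assume x: "x \<in> M"
    have "x \<notin> Units R"
    proof
      assume "x \<in> Units R"
      with x have "\<one> \<in> M" using M.I_r_closed[OF x, of "inv x"] by simp
      then show False using M.one_imp_carrier M.I_notcarr by simp
    qed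
    then show "x \<in> nonunits" using x M.Icarr by blast
  qed
  moreover have "nonunits \<subseteq> M"
  proof
    fix x assume x: "x \<in> nonunits"
    let ?P = "{J. ideal J R \<and> x \<in> J \<and> \<one> \<notin> J}"
    have "?P \<subseteq> Pow (carrier R)"
      using additive_subgroup.a_subset ideal.axioms(1) by blast
    then have "finite ?P" using finite_carrier finite_subset by blast
    moreover have "\<one> \<notin> PIdl x"
      using x m_comm unfolding cgenideal_def Units_def by auto
    then have "PIdl x \<in> ?P" using x cgenideal_ideal cgenideal_self by simp
    ultimately obtain J where J: "J \<in> ?P" and J_max: "\<And>K. K \<in> ?P \<Longrightarrow> J \<subseteq> K \<Longrightarrow> J = K"
      using finite_has_maximal[of ?P] by blast
    have "maximalideal J R"
    proof (rule maximalidealI)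
      show "ideal J R" "carrier R \<noteq> J" using J by auto
      fix K assume K: "ideal K R" "J \<subseteq> K" "K \<subseteq> carrier R"
      show "K = J \<or> K = carrier R"
        using J K J_max[of K] ideal.one_imp_carrier[OF K(1)] by blast
    qed
    then show "x \<in> M" using unique J by blast
  qed
  ultimately show ?thesis using M by simp
qed

sublocale nonunits: maximalideal nonunits R
  by (rule nonunits_is_maximal)

lemma zero_nonunit: "\<zero> \<in> nonunits"
  using nonunits.zero_closed .

lemma one_neq_zero: "\<one> \<noteq> \<zero>"
  using zero_nonunit Units_one_closed by (metis DiffD2)

lemma nonunit_mult: "x \<in> nonunits \<Longrightarrow> y \<in> carrier R \<Longrightarrow> x \<otimes> y \<in> nonunits"
  by (rule nonunits.I_r_closed)

lemma nonunit_add: "x \<in> nonunits \<Longrightarrow> y \<in> nonunits \<Longrightarrow> x \<oplus> y \<in> nonunits"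
  by (rule nonunits.a_closed)

lemma unit_add_nonunit:
  assumes "u \<in> Units R" "x \<in> nonunits"
  shows "u \<oplus> x \<in> Units R"
proof (rule ccontr)
  assume "u \<oplus> x \<notin> Units R"
  then have "u \<oplus> x \<in> nonunits" using assms by (simp add: Units_closed)
  then have "(u \<oplus> x) \<oplus> (\<ominus> x) \<in> nonunits"
    using assms nonunits.a_inv_closed nonunit_add by blast
  then show False using assms by (simp add: a_assoc r_neg Units_closed)
qed

text \<open>
  The order of the residue field, without constructing that field.
\<close>

definition residue_card :: nat where
  "residue_card = card (a_rcosets nonunits)"

definition maximal_card :: nat where
  "maximal_card = card nonunits"

lemma card_carrier: "card (carrier R) = residue_card * maximal_card"
  using a_lagrange[OF finite_carrier nonunits.additive_subgroup_axioms]
  by (simp add: residue_card_def maximal_card_def order_def)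

lemma maximal_card_pos: "maximal_card \<ge> 1"
  using zero_nonunit finite_carrier unfolding maximal_card_def
  by (metis One_nat_def Suc_leI card_gt_0_iff empty_iff finite_Diff)

lemma card_Units: "card (Units R) = (residue_card - 1) * maximal_card"
proof -
  have "card nonunits = card (carrier R) - card (Units R)"
    using finite_carrier by (simp add: card_Diff_subset Units_closed subsetI finite_ring_finite_units)
  moreover have "card (Units R) \<le> card (carrier R)"
    by (simp add: card_mono finite_carrier Units_closed subsetI)
  ultimately show ?thesis
    using card_carrier by (simp add: maximal_card_def diff_mult_distrib)
qed

lemma residue_card_ge_2: "residue_card \<ge> 2"
proof (rule ccontr)
  assume "\<not> residue_card \<ge> 2"
  then have "card (Units R) = 0" using card_Units by simp
  then show False using finite_ring_finite_units[OF finite_carrier] Units_one_closed by auto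
qed

text \<open>
  If the product were the nonzero element \<open>x\<close> of \<open>M = {0, x}\<close>, then \<open>x = x y\<close>, that is \<open>(1 - y) x = 0\<close> with
  \<open>1 - y\<close> a unit.
\<close>

lemma square_zero_if_maximal_card_2:
  assumes "maximal_card = 2" "x \<in> nonunits" "y \<in> nonunits"
  shows "x \<otimes> y = \<zero>"
proof (rule ccontr)
  assume nz: "x \<otimes> y \<noteq> \<zero>"
  then have "x \<noteq> \<zero>" "y \<noteq> \<zero>" using assms by auto
  \<comment> \<open>There is no room for a second nonzero nonunit.\<close>
  have two: "z = w" if "z \<in> nonunits" "w \<in> nonunits" "z \<noteq> \<zero>" "w \<noteq> \<zero>" for z w
  proof (rule ccontr)
    assume "z \<noteq> w"
    then have "card {\<zero>, z, w} = 3" using that by simp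
    moreover have "{\<zero>, z, w} \<subseteq> nonunits" using that zero_nonunit by simp
    ultimately show False
      using assms(1) card_mono[of nonunits "{\<zero>, z, w}"] finite_carrier
      unfolding maximal_card_def by simp
  qed
  have "x \<otimes> y \<in> nonunits" using assms nonunit_mult by blast
  then have "x \<otimes> y = x"
    using assms(2) nz \<open>x \<noteq> \<zero>\<close> two by metis
  have "\<one> \<oplus> \<ominus> y \<in> Units R" using assms nonunits.a_inv_closed unit_add_nonunit by blast
  moreover have "(\<one> \<oplus> \<ominus> y) \<otimes> x = \<zero>"
    using assms \<open>x \<otimes> y = x\<close> by (simp add: m_comm[of _ x] r_distr r_minus r_neg)
  ultimately have "x = \<zero>" using assms by (metis DiffD1 Units_closed Units_l_cancel r_null zero_closed)
  then show False using \<open>x \<noteq> \<zero>\<close> by simp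
qed

section \<open>Counting tuples with product zero\<close>

lemma finprod_Units:
  assumes "finite A" "\<And>i. i \<in> A \<Longrightarrow> x i \<in> Units R"
  shows "(\<Otimes>i\<in>A. x i) \<in> Units R"
  using assms
proof (induction A rule: finite_induct)
  case (insert a A)
  then show ?case by (subst finprod_insert) (auto intro: Units_closed)
qed simp

definition unit_tuples :: "nat \<Rightarrow> (nat \<Rightarrow> 'a) set" where
  "unit_tuples k = {1..k} \<rightarrow>\<^sub>E Units R"

definition one_nonunit_tuples :: "nat \<Rightarrow> (nat \<Rightarrow> 'a) set" where
  "one_nonunit_tuples k =
     (\<Union>i\<in>{1..k}. \<Pi>\<^sub>E j\<in>{1..k}. if j = i then nonunits - {\<zero>} else Units R)"

text \<open>
  Unlike the two sets before it, this one contains only tuples with nonzero product; it measures the failure of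
  \<open>M\<^sup>2 = 0\<close>.
\<close>

definition many_nonunit_tuples :: "nat \<Rightarrow> (nat \<Rightarrow> 'a) set" where
  "many_nonunit_tuples k =
     {x \<in> {1..k} \<rightarrow>\<^sub>E carrier R. (\<Otimes>i\<in>{1..k}. x i) \<noteq> \<zero> \<and>
        (\<exists>i\<in>{1..k}. \<exists>j\<in>{1..k}. i \<noteq> j \<and> x i \<in> nonunits \<and> x j \<in> nonunits)}"

lemma card_unit_tuples: "card (unit_tuples k) = card (Units R) ^ k"
  by (simp add: unit_tuples_def card_PiE)

lemma card_one_nonunit_tuples:
  "card (one_nonunit_tuples k) = k * (maximal_card - 1) * card (Units R) ^ (k - 1)"
proof -
  let ?T = "\<lambda>i. \<Pi>\<^sub>E j\<in>{1..k}. if j = i then nonunits - {\<zero>} else Units R"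
  have fin: "finite (?T i)" for i
    using finite_carrier by (intro finite_PiE) auto
  have disj: "?T i \<inter> ?T j = {}" if "i \<in> {1..k}" "j \<in> {1..k}" "i \<noteq> j" for i j
  proof -
    have False if "x \<in> ?T i" "x \<in> ?T j" for x
      using PiE_mem[OF that(1) \<open>i \<in> {1..k}\<close>] PiE_mem[OF that(2) \<open>i \<in> {1..k}\<close>] \<open>i \<noteq> j\<close> by simp
    then show ?thesis by blast
  qed
  have card1: "card (nonunits - {\<zero>}) = maximal_card - 1"
    using zero_nonunit by (simp add: maximal_card_def card_Diff_singleton)
  have "card (?T i) = (maximal_card - 1) * card (Units R) ^ (k - 1)" if i: "i \<in> {1..k}" for i
  proof -
    have "card (?T i) = (\<Prod>j\<in>{1..k}. if j = i then maximal_card - 1 else card (Units R))"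
      by (subst card_PiE, simp) (intro prod.cong refl, simp only: card1 split: if_split, simp)
    also have "\<dots> = (maximal_card - 1) * (\<Prod>j\<in>{1..k} - {i}. card (Units R))"
      using i by (subst prod.remove[of _ i]) (auto intro!: prod.cong)
    also have "\<dots> = (maximal_card - 1) * card (Units R) ^ (k - 1)"
      using i by simp
    finally show ?thesis .
  qed
  then show ?thesis
    unfolding one_nonunit_tuples_def
    by (subst card_UN_disjoint) (use fin disj in auto)
qed

lemma one_nonunit_tuplesE:
  assumes "x \<in> one_nonunit_tuples k"
  obtains i where "i \<in> {1..k}" "x i \<in> nonunits" "x i \<noteq> \<zero>"
    "\<And>j. j \<in> {1..k} \<Longrightarrow> j \<noteq> i \<Longrightarrow> x j \<in> Units R"
proof -
  obtain i where i: "i \<in> {1..k}"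
    and x: "x \<in> (\<Pi>\<^sub>E j\<in>{1..k}. if j = i then nonunits - {\<zero>} else Units R)"
    using assms unfolding one_nonunit_tuples_def by blast
  show thesis
  proof (rule that[OF i])
    show "x i \<in> nonunits" "x i \<noteq> \<zero>" using PiE_mem[OF x i] by auto
    show "x j \<in> Units R" if "j \<in> {1..k}" "j \<noteq> i" for j
      using PiE_mem[OF x that(1)] that(2) by simp
  qed
qed

lemma unit_tuples_product: "x \<in> unit_tuples k \<Longrightarrow> (\<Otimes>i\<in>{1..k}. x i) \<noteq> \<zero>"
  using finprod_Units[of "{1..k}" x] zero_nonunit unfolding unit_tuples_def by (metis DiffD2 PiE_mem finite_atLeastAtMost)

lemma one_nonunit_tuples_product:
  assumes "x \<in> one_nonunit_tuples k"
  shows "(\<Otimes>i\<in>{1..k}. x i) \<noteq> \<zero>"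
proof
  assume zero: "(\<Otimes>i\<in>{1..k}. x i) = \<zero>"
  obtain i where i: "i \<in> {1..k}" and xi: "x i \<in> nonunits" "x i \<noteq> \<zero>"
    and xj: "\<And>j. j \<in> {1..k} \<Longrightarrow> j \<noteq> i \<Longrightarrow> x j \<in> Units R"
    using assms by (elim one_nonunit_tuplesE) blast
  let ?u = "\<Otimes>j\<in>{1..k} - {i}. x j"
  have u: "?u \<in> Units R" using xj by (intro finprod_Units) auto
  have "(\<Otimes>i\<in>insert i ({1..k} - {i}). x i) = x i \<otimes> ?u"
    by (rule finprod_insert) (use xi xj in \<open>auto intro: Units_closed\<close>)
  moreover have "insert i ({1..k} - {i}) = {1..k}" using i by blast
  ultimately have "x i \<otimes> ?u = \<zero>" using zero by simp
  then have "?u \<otimes> x i = ?u \<otimes> \<zero>" using xi u by (simp add: m_comm Units_closed)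
  then show False using u xi by (metis DiffD1 Units_l_cancel zero_closed)
qed

lemma nonzero_product_tuples:
  "{x \<in> {1..k} \<rightarrow>\<^sub>E carrier R. (\<Otimes>i\<in>{1..k}. x i) \<noteq> \<zero>}
     = (unit_tuples k \<union> one_nonunit_tuples k) \<union> many_nonunit_tuples k" (is "?L = ?A \<union> ?B \<union> ?C")
proof
  show "?A \<union> ?B \<union> ?C \<subseteq> ?L"
  proof -
    have "?A \<subseteq> {1..k} \<rightarrow>\<^sub>E carrier R"
      unfolding unit_tuples_def by (rule PiE_mono) blast
    moreover have "?B \<subseteq> {1..k} \<rightarrow>\<^sub>E carrier R"
      unfolding one_nonunit_tuples_def by (intro UN_least PiE_mono) auto
    moreover have "?C \<subseteq> ?L" unfolding many_nonunit_tuples_def by blast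
    ultimately show ?thesis using unit_tuples_product one_nonunit_tuples_product by blast
  qed
  show "?L \<subseteq> ?A \<union> ?B \<union> ?C"
  proof
    fix x assume x: "x \<in> ?L"
    then have car: "x \<in> {1..k} \<rightarrow>\<^sub>E carrier R" and prod: "(\<Otimes>i\<in>{1..k}. x i) \<noteq> \<zero>" by auto
    consider "\<forall>i\<in>{1..k}. x i \<in> Units R"
      | i where "i \<in> {1..k}" "x i \<in> nonunits" "\<forall>j\<in>{1..k}. j \<noteq> i \<longrightarrow> x j \<in> Units R"
      | "\<exists>i\<in>{1..k}. \<exists>j\<in>{1..k}. i \<noteq> j \<and> x i \<in> nonunits \<and> x j \<in> nonunits"
    proof (cases "\<forall>i\<in>{1..k}. x i \<in> Units R")
      case False
      then obtain i where i: "i \<in> {1..k}" "x i \<in> nonunits" using PiE_mem[OF car] by blast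
      show thesis
      proof (cases "\<forall>j\<in>{1..k}. j \<noteq> i \<longrightarrow> x j \<in> Units R")
        case True
        then show thesis using that(2) i by blast
      next
        case False
        then obtain j where "j \<in> {1..k}" "j \<noteq> i" "x j \<in> nonunits" using PiE_mem[OF car] by blast
        then show thesis using that(3) i by blast
      qed
    qed (use that(1) in blast)
    then show "x \<in> ?A \<union> ?B \<union> ?C"
    proof cases
      case 1
      then show ?thesis using car unfolding unit_tuples_def PiE_def by blast
    next
      case 2
      have "x i \<noteq> \<zero>"
      proof
        assume "x i = \<zero>"
        have "(\<Otimes>i\<in>insert i ({1..k} - {i}). x i) = x i \<otimes> (\<Otimes>j\<in>{1..k} - {i}. x j)"
          by (rule finprod_insert) (use car 2 in auto)
        moreover have "insert i ({1..k} - {i}) = {1..k}" using 2 by blast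
        moreover have "(\<Otimes>j\<in>{1..k} - {i}. x j) \<in> carrier R" using car by (intro finprod_closed) auto
        ultimately show False using prod \<open>x i = \<zero>\<close> by simp
      qed
      then have "x \<in> (\<Pi>\<^sub>E j\<in>{1..k}. if j = i then nonunits - {\<zero>} else Units R)"
        using 2 car by (intro PiE_I) (auto dest: PiE_arb)
      then show ?thesis using 2(1) unfolding one_nonunit_tuples_def by blast
    next
      case 3
      then show ?thesis using x unfolding many_nonunit_tuples_def by blast
    qed
  qed
qed

lemma card_nonzero_product_tuples:
  "card {x \<in> {1..k} \<rightarrow>\<^sub>E carrier R. (\<Otimes>i\<in>{1..k}. x i) \<noteq> \<zero>}
     = card (Units R) ^ k + k * (maximal_card - 1) * card (Units R) ^ (k - 1)
       + card (many_nonunit_tuples k)"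
proof -
  have fin: "finite (unit_tuples k)" "finite (one_nonunit_tuples k)" "finite (many_nonunit_tuples k)"
  proof -
    have "finite {x \<in> {1..k} \<rightarrow>\<^sub>E carrier R. (\<Otimes>i\<in>{1..k}. x i) \<noteq> \<zero>}"
      by (rule finite_subset[OF Collect_restrict]) (simp add: finite_PiE finite_carrier)
    then show "finite (unit_tuples k)" "finite (one_nonunit_tuples k)" "finite (many_nonunit_tuples k)"
      unfolding nonzero_product_tuples by simp_all
  qed
  have "x \<notin> one_nonunit_tuples k" if "x \<in> unit_tuples k" for x
  proof
    assume "x \<in> one_nonunit_tuples k"
    then obtain i where "i \<in> {1..k}" "x i \<in> nonunits" by (rule one_nonunit_tuplesE)
    then show False using PiE_mem[OF that[unfolded unit_tuples_def]] by simp
  qed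
  then have d1: "unit_tuples k \<inter> one_nonunit_tuples k = {}" by blast
  have "x \<notin> many_nonunit_tuples k" if "x \<in> unit_tuples k \<union> one_nonunit_tuples k" for x
  proof
    assume "x \<in> many_nonunit_tuples k"
    then obtain i j where ij: "i \<in> {1..k}" "j \<in> {1..k}" "i \<noteq> j" "x i \<in> nonunits" "x j \<in> nonunits"
      unfolding many_nonunit_tuples_def by blast
    have "\<exists>l. \<forall>n\<in>{1..k}. n \<noteq> l \<longrightarrow> x n \<in> Units R"
      using \<open>x \<in> unit_tuples k \<union> one_nonunit_tuples k\<close>
    proof
      assume "x \<in> unit_tuples k"
      then have "x n \<in> Units R" if "n \<in> {1..k}" for n
        using that unfolding unit_tuples_def by (rule PiE_mem)
      then show ?thesis by simp
    next
      assume "x \<in> one_nonunit_tuples k"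
      then show ?thesis by (metis one_nonunit_tuplesE)
    qed
    then obtain l where l: "\<forall>n\<in>{1..k}. n \<noteq> l \<longrightarrow> x n \<in> Units R" ..
    have "i = l" using l ij(1,4) by (metis DiffD2)
    moreover have "j = l" using l ij(2,5) by (metis DiffD2)
    ultimately show False using \<open>i \<noteq> j\<close> by simp
  qed
  then have d2: "(unit_tuples k \<union> one_nonunit_tuples k) \<inter> many_nonunit_tuples k = {}" by blast
  show ?thesis
    unfolding nonzero_product_tuples using fin d1 d2
    by (simp add: card_Un_disjoint card_unit_tuples card_one_nonunit_tuples)
qed

text \<open>
  A nonzero product \<open>x y\<close> of two nonunits extends to the tuple \<open>(x, y, 1, \<dots>, 1)\<close>.
\<close>

lemma many_nonunit_tuples_empty_iff:
  assumes "k \<ge> 2"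
  shows "many_nonunit_tuples k = {} \<longleftrightarrow> (\<forall>x\<in>nonunits. \<forall>y\<in>nonunits. x \<otimes> y = \<zero>)"
proof
  assume empty: "many_nonunit_tuples k = {}"
  show "\<forall>x\<in>nonunits. \<forall>y\<in>nonunits. x \<otimes> y = \<zero>"
  proof (intro ballI, rule ccontr)
    fix x y assume xy: "x \<in> nonunits" "y \<in> nonunits" "x \<otimes> y \<noteq> \<zero>"
    \<comment> \<open>The tuple \<open>(x, y, 1, \<dots>, 1)\<close>\<close>
    define z where "z = (\<lambda>i\<in>{1..k}. if i = 1 then x else if i = 2 then y else \<one>)"
    have "(\<Otimes>i\<in>insert 1 (insert 2 {3..k}). z i) = x \<otimes> (y \<otimes> (\<Otimes>i\<in>{3..k}. z i))"
      using xy assms by (subst finprod_insert; (subst finprod_insert)?) (auto simp: z_def Pi_iff)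
    moreover have "(\<Otimes>i\<in>{3..k}. z i) = \<one>" by (rule finprod_one_eqI) (auto simp: z_def)
    moreover have "insert 1 (insert 2 {3..k}) = {1..k}" using assms by auto
    ultimately have "(\<Otimes>i\<in>{1..k}. z i) = x \<otimes> y" using xy by simp
    moreover have "z \<in> {1..k} \<rightarrow>\<^sub>E carrier R" using xy by (auto simp: z_def)
    moreover have "z 1 = x" "z 2 = y" using assms by (auto simp: z_def)
    moreover have "(1::nat) \<in> {1..k}" "2 \<in> {1..k}" "(1::nat) \<noteq> 2" using assms by auto
    ultimately have "z \<in> many_nonunit_tuples k"
      unfolding many_nonunit_tuples_def mem_Collect_eq using xy by metis
    then show False using empty by blast
  qed
next
  assume sq: "\<forall>x\<in>nonunits. \<forall>y\<in>nonunits. x \<otimes> y = \<zero>"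
  have False if x: "x \<in> many_nonunit_tuples k" for x
  proof -
    obtain i j where ij: "i \<in> {1..k}" "j \<in> {1..k}" "i \<noteq> j" "x i \<in> nonunits" "x j \<in> nonunits"
      and car: "x \<in> {1..k} \<rightarrow>\<^sub>E carrier R" and prod: "(\<Otimes>i\<in>{1..k}. x i) \<noteq> \<zero>"
      using x unfolding many_nonunit_tuples_def by blast
    let ?w = "\<Otimes>l\<in>{1..k} - {i, j}. x l"
    have w: "?w \<in> carrier R" using car by (intro finprod_closed) auto
    have "(\<Otimes>l\<in>insert i (insert j ({1..k} - {i, j})). x l) = x i \<otimes> (x j \<otimes> ?w)"
      using ij car by (subst finprod_insert; (subst finprod_insert)?) (auto simp: Pi_iff PiE_iff)
    moreover have "insert i (insert j ({1..k} - {i, j})) = {1..k}" using ij by blast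
    moreover have "x i \<otimes> (x j \<otimes> ?w) = \<zero>" using sq ij w by (simp add: m_assoc[symmetric])
    ultimately show False using prod by simp
  qed
  then show "many_nonunit_tuples k = {}" by blast
qed

lemma zp_eq:
  assumes "k \<ge> 1"
  shows "zp k R = max_zp k residue_card maximal_card
                    - card (many_nonunit_tuples k) / real (card (carrier R)) ^ k"
proof -
  let ?N = "real (card (carrier R))" and ?q = "real residue_card" and ?m = "real maximal_card"
  let ?All = "{1..k} \<rightarrow>\<^sub>E carrier R"
  let ?Z = "{x \<in> ?All. (\<Otimes>i\<in>{1..k}. x i) = \<zero>}" and ?W = "{x \<in> ?All. (\<Otimes>i\<in>{1..k}. x i) \<noteq> \<zero>}"
  have N: "?N = ?q * ?m" using card_carrier by simp
  have pos: "?q > 0" "?m > 0" using residue_card_ge_2 maximal_card_pos by auto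
  have u: "real (card (Units R)) = (?q - 1) * ?m"
    using card_Units residue_card_ge_2 by (simp add: of_nat_diff)
  have "finite ?All" by (simp add: finite_PiE finite_carrier)
  then have "card (?Z \<union> ?W) = card ?Z + card ?W"
    by (intro card_Un_disjoint) auto
  moreover have "?Z \<union> ?W = ?All" by blast
  moreover have "card ?All = card (carrier R) ^ k" by (simp add: card_PiE)
  ultimately have "card ?Z + card ?W = card (carrier R) ^ k" by metis
  then have "real (card ?Z) + real (card ?W) = ?N ^ k"
    by (simp only: of_nat_add[symmetric] of_nat_power)
  then have "real (card ?Z) = ?N ^ k - real (card ?W)" by linarith
  then have "zp k R = 1 - real (card ?W) / ?N ^ k"
    unfolding zp_def using pos N by (simp add: diff_divide_distrib)
  also have "real (card ?W) = ((?q - 1) * ?m) ^ k + real k * (?m - 1) * ((?q - 1) * ?m) ^ (k - 1)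
      + real (card (many_nonunit_tuples k))"
    unfolding card_nonzero_product_tuples using u maximal_card_pos by (simp add: of_nat_diff)
  also have "1 - (((?q - 1) * ?m) ^ k + real k * (?m - 1) * ((?q - 1) * ?m) ^ (k - 1)
      + real (card (many_nonunit_tuples k))) / ?N ^ k
    = 1 - ((?q - 1) * ?m) ^ k / ?N ^ k - real k * (?m - 1) * ((?q - 1) * ?m) ^ (k - 1) / ?N ^ k
      - card (many_nonunit_tuples k) / ?N ^ k"
    by (simp add: add_divide_distrib)
  also have "((?q - 1) * ?m) ^ k / ?N ^ k = ((?q - 1) / ?q) ^ k"
    using pos unfolding N power_divide[symmetric] by simp
  also have "real k * (?m - 1) * ((?q - 1) * ?m) ^ (k - 1) / ?N ^ k
      = real k * ((?q - 1) / ?q) ^ (k - 1) * (?m - 1) / (?q * ?m)"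
  proof -
    have "?N ^ k = ?N * ?N ^ (k - 1)" using assms by (cases k) auto
    then have "real k * (?m - 1) * ((?q - 1) * ?m) ^ (k - 1) / ?N ^ k
        = real k * (?m - 1) / ?N * (((?q - 1) * ?m) ^ (k - 1) / ?N ^ (k - 1))"
      by simp
    also have "((?q - 1) * ?m) ^ (k - 1) / ?N ^ (k - 1) = ((?q - 1) / ?q) ^ (k - 1)"
      using pos unfolding N power_divide[symmetric] by simp
    finally show ?thesis unfolding N by simp
  qed
  finally show ?thesis unfolding max_zp_def .
qed

lemma zp_le_max_zp:
  assumes "k \<ge> 1"
  shows "zp k R \<le> max_zp k residue_card maximal_card"
  using zp_eq[OF assms] by simp

lemma zp_eq_max_zp_iff:
  assumes "k \<ge> 2"
  shows "zp k R = max_zp k residue_card maximal_card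
           \<longleftrightarrow> (\<forall>x\<in>nonunits. \<forall>y\<in>nonunits. x \<otimes> y = \<zero>)"
proof -
  have "finite (many_nonunit_tuples k)"
    unfolding many_nonunit_tuples_def
    by (rule finite_subset[OF Collect_restrict]) (simp add: finite_PiE finite_carrier)
  moreover have "real (card (carrier R)) ^ k \<noteq> 0"
    using card_carrier residue_card_ge_2 maximal_card_pos by simp
  ultimately have "zp k R = max_zp k residue_card maximal_card \<longleftrightarrow> many_nonunit_tuples k = {}"
    using zp_eq[of k] assms by simp
  then show ?thesis using many_nonunit_tuples_empty_iff[OF assms] by simp
qed

lemma square_zero_if_maximal_card_le_2:
  assumes "maximal_card \<le> 2" "x \<in> nonunits" "y \<in> nonunits"
  shows "x \<otimes> y = \<zero>"
proof (cases "maximal_card = 2")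
  case False
  then have "card nonunits = 1" using assms(1) maximal_card_pos unfolding maximal_card_def by simp
  then have "nonunits = {\<zero>}" using zero_nonunit by (metis card_1_singletonE singletonD)
  then show ?thesis using assms(2,3) by (metis l_null singletonD zero_closed)
qed (use square_zero_if_maximal_card_2 assms in blast)

end

section \<open>Integer multiples in a ring\<close>

lemma (in ring) order_add_pow_eq_zero:
  assumes "x \<in> carrier R"
  shows "add_pow R (card (carrier R)) x = \<zero>"
  using group.pow_order_eq_1[OF a_group, of x] assms by (simp add: order_def add_pow_def)

text \<open>
  Cauchy's theorem for the additive group, read off from a subgroup of order \<open>p\<close>.
\<close>

lemma (in ring) prime_torsion:
  assumes "finite (carrier R)" "Factorial_Ring.prime p" "p dvd card (carrier R)"
  obtains x where "x \<in> carrier R" "x \<noteq> \<zero>" "add_pow R p x = \<zero>"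
proof -
  obtain m where "order (add_monoid R) = p ^ 1 * m"
    using assms(3) by (auto simp: order_def)
  then obtain H where H: "subgroup H (add_monoid R)" "card H = p"
    using sylow_thm[OF assms(2) a_group, of 1 m] assms(1) by auto
  have "p > 1" using assms(2) by (rule prime_gt_1_nat)
  then have "\<not> H \<subseteq> {\<zero>}" using H(2) card_mono[of "{\<zero>}" H] by auto
  then obtain x where x: "x \<in> H" "x \<noteq> \<zero>" by blast
  let ?H = "(add_monoid R)\<lparr>carrier := H\<rparr>"
  have "group ?H" using subgroup.subgroup_is_group[OF H(1) a_group] .
  then have "x [^]\<^bsub>?H\<^esub> p = \<zero>"
    using group.pow_order_eq_1[of ?H x] x H(2) by (simp add: order_def)
  then have "add_pow R p x = \<zero>"
    unfolding add_pow_def monoid.nat_pow_consistent[OF a_monoid, of x p H] .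
  then show thesis using that x subgroup.subset[OF H(1)] by auto
qed

abbreviation (in ring) int_multiple :: "int \<Rightarrow> 'a \<Rightarrow> 'a" (infixr "\<star>" 85) where
  "i \<star> x \<equiv> add_pow R i x"

lemma (in ring) int_multiple_zero [simp]: "0 \<star> x = \<zero>"
  by (simp add: add_pow_def)

lemma (in ring) int_multiple_mod:
  assumes "x \<in> carrier R" "n \<star> x = \<zero>"
  shows "(i mod n) \<star> x = i \<star> x"
proof -
  have "(n * (i div n)) \<star> x = \<zero>"
    using assms by (simp flip: add.int_pow_pow)
  moreover have "(n * (i div n) + i mod n) \<star> x = (n * (i div n)) \<star> x \<oplus> (i mod n) \<star> x"
    using assms(1) by (rule add.int_pow_mult)
  ultimately show ?thesis using assms(1) by simp
qed

lemma (in ring) int_multiple_mult: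
  assumes "x \<in> carrier R" "y \<in> carrier R"
  shows "(i \<star> x) \<otimes> (j \<star> y) = (i * j) \<star> (x \<otimes> y)"
  using assms by (simp add: add_pow_ldistr_int add_pow_rdistr_int add.int_pow_pow mult.commute)

lemma (in ring) int_multiple_one_mult:
  assumes "x \<in> carrier R"
  shows "(i \<star> \<one>) \<otimes> x = i \<star> x"
  using assms by (simp add: add_pow_ldistr_int)

lemma (in ring) two_multiple:
  assumes "x \<in> carrier R"
  shows "2 \<star> x = x \<oplus> x"
  using add.int_pow_mult[of x 1 1] assms by simp

section \<open>Isomorphisms with explicit rings\<close>

text \<open>
  The homomorphism goes from the model ring \<open>S\<close> to \<open>R\<close>, because it is easy to write down by sending the generators of \<open>S\<close>
  to chosen elements of \<open>R\<close>.
\<close>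

lemma ring_iso_if_trivial_kernel:
  assumes "ring S" "ring R" "h \<in> ring_hom S R"
    and "finite (carrier R)" "card (carrier S) = card (carrier R)"
    and ker: "\<And>x. x \<in> carrier S \<Longrightarrow> h x = \<zero>\<^bsub>R\<^esub> \<Longrightarrow> x = \<zero>\<^bsub>S\<^esub>"
  shows "R \<simeq> S"
proof -
  interpret h: ring_hom_ring S R h
    using assms(1-3) by (intro ring_hom_ringI2)
  have inj: "inj_on h (carrier S)"
  proof (rule inj_onI)
    fix x y assume xy: "x \<in> carrier S" "y \<in> carrier S" "h x = h y"
    then have "h (x \<ominus>\<^bsub>S\<^esub> y) = \<zero>\<^bsub>R\<^esub>"
      by (simp add: h.R.minus_eq h.S.r_neg)
    then have "x \<ominus>\<^bsub>S\<^esub> y = \<zero>\<^bsub>S\<^esub>" using xy ker by simp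
    then show "x = y" using xy by simp
  qed
  have "h ` carrier S = carrier R"
    using assms(4,5) card_image[OF inj] by (intro card_subset_eq) auto
  then have "S \<simeq> R"
    using inj assms(3) unfolding is_ring_iso_def ring_iso_def bij_betw_def by auto
  then show ?thesis by (rule ring_iso_sym[OF assms(1)])
qed

lemma ring_residue_ring: "n > 1 \<Longrightarrow> ring (residue_ring n)"
  using residues.cring[of n] by (simp add: residues_def cring.axioms(1))

lemma (in ring) int_multiples_hom:
  assumes "n \<star> \<one> = \<zero>"
  shows "(\<lambda>i. i \<star> \<one>) \<in> ring_hom (residue_ring n) R"
  by (rule ring_hom_memI)
     (use assms in \<open>simp_all add: residue_ring_def int_multiple_mod int_multiple_mult add.int_pow_mult\<close>)

lemma (in ring) iso_residue_ring:
  assumes "n > 1" "card (carrier R) = n"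
    and "\<And>i::int. 0 < i \<Longrightarrow> i < int n \<Longrightarrow> i \<star> \<one> \<noteq> \<zero>"
  shows "R \<simeq> residue_ring (int n)"
proof (rule ring_iso_if_trivial_kernel[where h = "\<lambda>i. i \<star> \<one>"])
  have "add_pow R n \<one> = \<zero>" using order_add_pow_eq_zero[of \<one>] assms(2) by simp
  then have "(int n) \<star> \<one> = \<zero>" by (simp add: add_pow_int_ge)
  then show "(\<lambda>i. i \<star> \<one>) \<in> ring_hom (residue_ring (int n)) R" by (rule int_multiples_hom)
  show "finite (carrier R)" using assms(1,2) card_gt_0_iff[of "carrier R"] by simp
  fix i assume "i \<in> carrier (residue_ring (int n))" "i \<star> \<one> = \<zero>"
  moreover from this have "\<not> 0 < i" using assms(3)[of i] by (auto simp: residue_ring_def)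
  ultimately show "i = \<zero>\<^bsub>residue_ring (int n)\<^esub>" by (auto simp: residue_ring_def)
qed (use assms in \<open>simp_all add: residue_ring_def ring_axioms ring_residue_ring[unfolded residue_ring_def]\<close>)

text \<open>
  The image of \<open>M\<close> must multiply to zero, as \<open>M\<close> does inside the idealization; every other condition
  says that \<open>f\<close> is linear over the integers.
\<close>

lemma (in cring) idealization_hom:
  assumes char: "n \<star> \<one> = \<zero>"
    and f_closed: "\<And>x. x \<in> carrier M \<Longrightarrow> f x \<in> carrier R"
    and f_zero: "f \<zero>\<^bsub>M\<^esub> = \<zero>"
    and f_add: "\<And>x y. x \<in> carrier M \<Longrightarrow> y \<in> carrier M \<Longrightarrow> f (x \<oplus>\<^bsub>M\<^esub> y) = f x \<oplus> f y"
    and f_smult: "\<And>r x. x \<in> carrier M \<Longrightarrow> f (r \<odot>\<^bsub>M\<^esub> x) = r \<star> f x"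
    and f_mult: "\<And>x y. x \<in> carrier M \<Longrightarrow> y \<in> carrier M \<Longrightarrow> f x \<otimes> f y = \<zero>"
    and M: "module (residue_ring n) M"
  shows "(\<lambda>(r, x). r \<star> \<one> \<oplus> f x) \<in> ring_hom (idealization (residue_ring n) M) R"
proof -
  interpret M: module "residue_ring n" M by fact
  let ?S = "residue_ring n"
  have hom: "(r \<otimes>\<^bsub>?S\<^esub> s) \<star> \<one> = (r \<star> \<one>) \<otimes> (s \<star> \<one>)" "(r \<oplus>\<^bsub>?S\<^esub> s) \<star> \<one> = r \<star> \<one> \<oplus> s \<star> \<one>"
    "(\<one>\<^bsub>?S\<^esub>) \<star> \<one> = \<one>" for r s :: int
    using char
    by (simp_all add: residue_ring_def int_multiple_mod int_multiple_mult add.int_pow_mult)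
  have expand: "(p \<oplus> a) \<otimes> (q \<oplus> b) = (p \<otimes> q \<oplus> q \<otimes> a) \<oplus> (p \<otimes> b \<oplus> a \<otimes> b)"
    if "p \<in> carrier R" "a \<in> carrier R" "q \<in> carrier R" "b \<in> carrier R" for p a q b
    using that by (simp add: l_distr r_distr a_ac m_ac)
  show ?thesis
  proof (rule ring_hom_memI, goal_cases)
    case (1 z)
    then show ?case using f_closed by (auto simp: idealization_def)
  next
    case (2 z w)
    then obtain r x s y where zw: "z = (r, x)" "w = (s, y)" "r \<in> carrier ?S" "s \<in> carrier ?S"
      "x \<in> carrier M" "y \<in> carrier M" by (auto simp: idealization_def)
    let ?r = "r \<star> \<one>" and ?s = "s \<star> \<one>"
    have "(?r \<oplus> f x) \<otimes> (?s \<oplus> f y) = (?r \<otimes> ?s \<oplus> ?s \<otimes> f x) \<oplus> (?r \<otimes> f y \<oplus> f x \<otimes> f y)"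
      using expand[of ?r "f x" ?s "f y"] zw f_closed by simp
    also have "\<dots> = ?r \<otimes> ?s \<oplus> (?r \<otimes> f y \<oplus> ?s \<otimes> f x)"
      using zw f_closed by (simp add: f_mult a_ac)
    finally show ?case
      using zw f_closed by (simp add: idealization_def hom f_add f_smult int_multiple_one_mult)
  next
    case (3 z w)
    then show ?case
      using f_closed by (auto simp: idealization_def hom f_add a_ac)
  next
    case 4
    then show ?case using f_zero hom by (simp add: idealization_def)
  qed
qed

lemma (in cring) iso_idealization_residue_module:
  assumes n: "n > 1" "d > 0" "d dvd n" "n \<star> \<one> = \<zero>"
    and a: "a \<in> carrier R" "d \<star> a = \<zero>" "a \<otimes> a = \<zero>"
    and R: "finite (carrier R)" "int (card (carrier R)) = n * d"
    and ker: "\<And>r i. r \<in> {0..n - 1} \<Longrightarrow> i \<in> {0..d - 1} \<Longrightarrow> r \<star> \<one> \<oplus> i \<star> a = \<zero> \<Longrightarrow> r = 0 \<and> i = 0"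
  shows "R \<simeq> idealization (residue_ring n) (residue_module d)"
proof (rule ring_iso_if_trivial_kernel)
  have M: "module (residue_ring n) (residue_module d)"
    using n(1-3) by (rule module_residue_module)
  then show "ring (idealization (residue_ring n) (residue_module d))"
    using cring_idealization cring.axioms(1) by blast
  show "(\<lambda>(r, i). r \<star> \<one> \<oplus> i \<star> a) \<in> ring_hom (idealization (residue_ring n) (residue_module d)) R"
    by (rule idealization_hom[OF n(4) _ _ _ _ _ M])
       (use a in \<open>simp_all add: residue_module_def int_multiple_mod int_multiple_mult
          add.int_pow_mult add.int_pow_pow mult.commute\<close>)
  have "int (card (carrier (idealization (residue_ring n) (residue_module d)))) = n * d"
    using n by (simp add: idealization_def residue_ring_def residue_module_def)
  then show "card (carrier (idealization (residue_ring n) (residue_module d))) = card (carrier R)"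
    using R(2) by simp
  fix z assume z: "z \<in> carrier (idealization (residue_ring n) (residue_module d))"
    "(case z of (r, i) \<Rightarrow> r \<star> \<one> \<oplus> i \<star> a) = \<zero>"
  obtain r i where ri: "z = (r, i)" by (cases z)
  have "r = 0 \<and> i = 0"
    by (rule ker) (use z in \<open>simp_all add: ri idealization_def residue_ring_def residue_module_def\<close>)
  then show "z = \<zero>\<^bsub>idealization (residue_ring n) (residue_module d)\<^esub>"
    by (simp add: ri idealization_def residue_ring_def residue_module_def)
qed (rule ring_axioms, rule R(1))

lemma (in cring) iso_idealization_residue_module_sum:
  assumes n: "n > 1" "n \<star> \<one> = \<zero>"
    and a: "a \<in> carrier R" "a \<otimes> a = \<zero>" and b: "b \<in> carrier R" "b \<otimes> b = \<zero>" "a \<otimes> b = \<zero>"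
    and R: "finite (carrier R)" "int (card (carrier R)) = n * (n * n)"
    and ker: "\<And>r i j. r \<in> {0..n - 1} \<Longrightarrow> i \<in> {0..n - 1} \<Longrightarrow> j \<in> {0..n - 1} \<Longrightarrow>
                r \<star> \<one> \<oplus> (i \<star> a \<oplus> j \<star> b) = \<zero> \<Longrightarrow> r = 0 \<and> i = 0 \<and> j = 0"
  shows "R \<simeq> idealization (residue_ring n) (module_sum (residue_module n) (residue_module n))"
    (is "R \<simeq> ?S")
proof (rule ring_iso_if_trivial_kernel)
  let ?M = "module_sum (residue_module n) (residue_module n)"
  let ?f = "\<lambda>(i, j). i \<star> a \<oplus> j \<star> b"
  have M: "module (residue_ring n) ?M"
    using n by (intro module_module_sum module_residue_module) auto
  then show "ring ?S" using cring_idealization cring.axioms(1) by blast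
  have torsion: "n \<star> x = \<zero>" if "x \<in> carrier R" for x
    using int_multiple_one_mult[OF that, of n] n(2) that by simp
  have M_simps: "carrier ?M = {0..n - 1} \<times> {0..n - 1}" "\<zero>\<^bsub>?M\<^esub> = (0, 0)"
    "(i, j) \<oplus>\<^bsub>?M\<^esub> (i', j') = ((i + i') mod n, (j + j') mod n)"
    "r \<odot>\<^bsub>?M\<^esub> (i, j) = ((r * i) mod n, (r * j) mod n)" for i j i' j' r
    by (simp_all add: module_sum_def residue_module_def)
  show "(\<lambda>(r, x). r \<star> \<one> \<oplus> ?f x) \<in> ring_hom ?S R"
  proof (rule idealization_hom[OF n(2) _ _ _ _ _ M])
    fix x y assume "x \<in> carrier ?M" "y \<in> carrier ?M"
    obtain i j i' j' where xy: "x = (i, j)" "y = (i', j')" by fastforce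
    show "?f (x \<oplus>\<^bsub>?M\<^esub> y) = ?f x \<oplus> ?f y"
      using a b by (simp add: xy M_simps int_multiple_mod torsion add.int_pow_mult a_ac)
    show "?f x \<otimes> ?f y = \<zero>"
      using a b m_comm[of b a]
      by (simp add: xy l_distr r_distr int_multiple_mult)
  next
    fix r x
    show "?f (r \<odot>\<^bsub>?M\<^esub> x) = r \<star> ?f x"
      using a b by (cases x)
        (simp add: M_simps int_multiple_mod torsion add.int_pow_distrib add.int_pow_pow mult.commute)
  qed (use a b in \<open>auto simp: M_simps\<close>)
  have "int (card (carrier ?S)) = n * (n * n)"
    using n by (simp add: idealization_def residue_ring_def M_simps)
  then show "card (carrier ?S) = card (carrier R)" using R(2) by simp
  fix z assume z: "z \<in> carrier ?S" "(case z of (r, x) \<Rightarrow> r \<star> \<one> \<oplus> ?f x) = \<zero>"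
  obtain r i j where rij: "z = (r, i, j)" by (cases z)
  have "r = 0 \<and> i = 0 \<and> j = 0"
    by (rule ker) (use z in \<open>simp_all add: rij idealization_def residue_ring_def M_simps\<close>)
  then show "z = \<zero>\<^bsub>?S\<^esub>"
    by (simp add: rij idealization_def residue_ring_def M_simps)
qed (rule ring_axioms, rule R(1))

text \<open>
  Here \<open>w\<close> is a root of \<open>X\<^sup>2 + X + 1\<close>; the pair \<open>(a, b)\<close> is sent to \<open>a + b w\<close>.
\<close>

lemma (in cring) iso_GF4:
  assumes char: "2 \<star> \<one> = \<zero>" and w: "w \<in> carrier R" "w \<otimes> w = \<one> \<oplus> w"
    and card: "card (carrier R) = 4"
    and ker: "\<one> \<noteq> \<zero>" "w \<noteq> \<zero>" "\<one> \<oplus> w \<noteq> \<zero>"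
  shows "R \<simeq> GF4"
proof (rule ring_iso_if_trivial_kernel)
  show "ring GF4" using field_GF4 unfolding field_def domain_def cring_def by blast
  have torsion: "2 \<star> x = \<zero>" if "x \<in> carrier R" for x
    using int_multiple_one_mult[OF that, of 2] char that by simp
  have mult: "(a \<star> \<one> \<oplus> b \<star> w) \<otimes> (c \<star> \<one> \<oplus> d \<star> w)
      = (a * c + b * d) \<star> \<one> \<oplus> (a * d + b * c + b * d) \<star> w" for a b c d
  proof -
    have "(a \<star> \<one> \<oplus> b \<star> w) \<otimes> (c \<star> \<one> \<oplus> d \<star> w)
        = ((a * c) \<star> \<one> \<oplus> (b * c) \<star> w) \<oplus> ((a * d) \<star> w \<oplus> (b * d) \<star> (w \<otimes> w))"
      using w(1) by (simp add: l_distr r_distr int_multiple_mult)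
    also have "(b * d) \<star> (w \<otimes> w) = (b * d) \<star> \<one> \<oplus> (b * d) \<star> w"
      using w by (simp add: add.int_pow_distrib)
    finally show ?thesis using w(1) by (simp add: add.int_pow_mult a_ac)
  qed
  show "(\<lambda>(a, b). a \<star> \<one> \<oplus> b \<star> w) \<in> ring_hom GF4 R"
  proof (rule ring_hom_memI, goal_cases)
    case (2 x y)
    obtain a b c d where "x = (a, b)" "y = (c, d)" by fastforce
    then show ?case using w(1) by (simp add: mult) (simp add: GF4_def int_multiple_mod torsion)
  next
    case (3 x y)
    then show ?case
      using w(1) by (auto simp: GF4_def int_multiple_mod torsion add.int_pow_mult a_ac)
  qed (use w in \<open>auto simp: GF4_def\<close>)
  show "card (carrier GF4) = card (carrier R)" using order_GF4 card by (simp add: order_def)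
  show "finite (carrier R)" using card card_gt_0_iff[of "carrier R"] by simp
  fix z assume "z \<in> carrier GF4" "(case z of (a, b) \<Rightarrow> a \<star> \<one> \<oplus> b \<star> w) = \<zero>"
  then show "z = \<zero>\<^bsub>GF4\<^esub>"
    using ker w(1) unfolding carrier_GF4 by (auto simp: GF4_def)
qed (rule ring_axioms)

section \<open>Identifying the rings of small order\<close>

context finite_local_ring begin

text \<open>
  With only two cosets of \<open>M\<close>, the units are the coset of 1.
\<close>

lemma Units_eq_one_add_nonunits:
  assumes "residue_card = 2"
  shows "(\<lambda>x. \<one> \<oplus> x) ` nonunits = Units R"
proof (rule card_subset_eq)
  show "finite (Units R)" using finite_carrier by blast
  show "(\<lambda>x. \<one> \<oplus> x) ` nonunits \<subseteq> Units R" using unit_add_nonunit by blast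
  have "inj_on (\<lambda>x. \<one> \<oplus> x) nonunits" by (rule inj_onI) simp
  then show "card ((\<lambda>x. \<one> \<oplus> x) ` nonunits) = card (Units R)"
    using card_Units assms by (simp add: card_image maximal_card_def)
qed

lemma two_nonunit:
  assumes "residue_card = 2"
  shows "2 \<star> \<one> \<in> nonunits"
proof (rule ccontr)
  assume "2 \<star> \<one> \<notin> nonunits"
  then have "\<one> \<oplus> \<one> \<in> Units R" by (simp add: two_multiple)
  then have "\<one> \<oplus> \<one> \<in> (\<lambda>x. \<one> \<oplus> x) ` nonunits"
    using Units_eq_one_add_nonunits[OF assms] by simp
  then obtain x where x: "x \<in> nonunits" "\<one> \<oplus> \<one> = \<one> \<oplus> x" by (rule imageE)
  then have "x = \<one>" by simp
  then show False using x(1) by simp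
qed

text \<open>
  \<open>1 + 1\<close> is a nonunit, so \<open>1 + (1 + 1)\<close> lies in the coset of 1.
\<close>

lemma three_unit:
  assumes "residue_card = 2"
  shows "3 \<star> \<one> \<in> Units R"
proof -
  have "3 \<star> \<one> = \<one> \<oplus> 2 \<star> \<one>"
    using add.int_pow_mult[of \<one> 1 2] by simp
  then show ?thesis using unit_add_nonunit[OF _ two_nonunit[OF assms]] by simp
qed

text \<open>
  An element of additive order 3 would be annihilated by the unit \<open>1 + 1 + 1\<close>.
\<close>

lemma three_not_dvd_card:
  assumes "residue_card = 2"
  shows "\<not> 3 dvd card (carrier R)"
proof
  assume "3 dvd card (carrier R)"
  moreover have "Factorial_Ring.prime (3::nat)" by simp
  ultimately obtain x where x: "x \<in> carrier R" "x \<noteq> \<zero>" "add_pow R (3::nat) x = \<zero>"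
    using prime_torsion[OF finite_carrier] by blast
  then have "3 \<star> x = \<zero>" by (simp add: add_pow_int_ge)
  then have "(3 \<star> \<one>) \<otimes> x = (3 \<star> \<one>) \<otimes> \<zero>"
    using x(1) by (simp add: int_multiple_one_mult)
  then have "x = \<zero>" using three_unit[OF assms] x(1) Units_l_cancel[of "3 \<star> \<one>" x \<zero>] by simp
  then show False using x(2) by simp
qed

lemma obtain_nonunit:
  assumes "finite A" "card A < maximal_card"
  obtains x where "x \<in> nonunits" "x \<notin> A"
proof -
  have "\<not> nonunits \<subseteq> A"
    using assms(2) card_mono[OF assms(1), of nonunits] unfolding maximal_card_def by (metis leD)
  then show thesis using that by blast
qed

lemma two_multiple_eq_zero:
  assumes "2 \<star> \<one> \<otimes> x = \<zero>" "x \<in> carrier R"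
  shows "2 \<star> x = \<zero>"
  using assms by (simp add: int_multiple_one_mult)

lemma one_add_nonunit_neq_zero:
  assumes "u \<in> Units R" "x \<in> nonunits"
  shows "u \<oplus> x \<noteq> \<zero>"
  using unit_add_nonunit[OF assms] zero_nonunit by auto

text \<open>
  The characteristic decides: \<open>1 + 1\<close> is a nonunit, hence either 0 or the nonzero element of \<open>M\<close>.
\<close>

lemma iso_maximal_card_2:
  assumes q: "residue_card = 2" and m: "maximal_card = 2"
  shows "R \<simeq> residue_ring 4 \<or> R \<simeq> idealization (residue_ring 2) (residue_module 2)"
proof (cases "2 \<star> \<one> = \<zero>")
  case False
  have "i \<star> \<one> \<noteq> \<zero>" if "0 < i" "i < int 4" for i
  proof -
    have "i = 1 \<or> i = 2 \<or> i = 3" using that by auto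
    then show ?thesis using False three_unit[OF q] zero_nonunit one_neq_zero by auto
  qed
  then have "R \<simeq> residue_ring (int 4)"
    using card_carrier q m by (intro iso_residue_ring) auto
  then show ?thesis by simp
next
  case True
  obtain a where a: "a \<in> nonunits" "a \<notin> {\<zero>}" using m obtain_nonunit[of "{\<zero>}"] by auto
  have "R \<simeq> idealization (residue_ring 2) (residue_module 2)"
  proof (rule iso_idealization_residue_module)
    show "a \<otimes> a = \<zero>" using square_zero_if_maximal_card_2 m a(1) by blast
    show "2 \<star> a = \<zero>" using a True by (intro two_multiple_eq_zero) auto
    show "int (card (carrier R)) = 2 * 2" using card_carrier q m by simp
    fix r i :: int assume "r \<in> {0..2 - 1}" "i \<in> {0..2 - 1}" and zero: "r \<star> \<one> \<oplus> i \<star> a = \<zero>"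
    then have "r = 0 \<or> r = 1" "i = 0 \<or> i = 1" by auto
    then show "r = 0 \<and> i = 0"
      using zero a one_neq_zero one_add_nonunit_neq_zero[OF Units_one_closed a(1)] by auto
  qed (use True a finite_carrier in auto)
  then show ?thesis ..
qed

text \<open>
  As \<open>1 + 1 \<in> M\<close> and \<open>M\<^sup>2 = 0\<close>, the ideal \<open>M\<close> is a vector space of dimension 2 over the field with two
  elements. If \<open>1 + 1 \<noteq> 0\<close>, it is part of a basis of \<open>M\<close> and the other basis vector spans the module \<open>\<int>\<^sub>2\<close>;
  otherwise both basis vectors belong to the module.
\<close>

lemma iso_maximal_card_4:
  assumes q: "residue_card = 2" and m: "maximal_card = 4"
    and sq: "\<forall>x\<in>nonunits. \<forall>y\<in>nonunits. x \<otimes> y = \<zero>"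
  shows "R \<simeq> idealization (residue_ring 4) (residue_module 2) \<or>
         R \<simeq> idealization (residue_ring 2) (module_sum (residue_module 2) (residue_module 2))"
proof -
  have torsion: "2 \<star> x = \<zero>" if "x \<in> nonunits" for x
    using that sq two_nonunit[OF q] by (intro two_multiple_eq_zero) auto
  have add_eq_zero: "x = y" if "x \<oplus> y = \<zero>" "x \<in> nonunits" "y \<in> nonunits" for x y
  proof -
    have "x \<oplus> y = y \<oplus> y" using that torsion[of y] two_multiple[of y] by simp
    then show ?thesis using that by simp
  qed
  show ?thesis
  proof (cases "2 \<star> \<one> = \<zero>")
    case False
    obtain b where b: "b \<in> nonunits" "b \<notin> {\<zero>, 2 \<star> \<one>}"
      using m obtain_nonunit[of "{\<zero>, 2 \<star> \<one>}"] card_insert_le_m1[of 2 "{2 \<star> \<one>}" "\<zero>"] by auto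
    have "R \<simeq> idealization (residue_ring 4) (residue_module 2)"
    proof (rule iso_idealization_residue_module)
      have "4 \<star> \<one> = 2 \<star> (2 \<star> \<one>)" by (simp add: add.int_pow_pow)
      then show "4 \<star> \<one> = \<zero>" using torsion two_nonunit[OF q] by simp
      show "2 \<star> b = \<zero>" using b torsion by simp
      show "b \<otimes> b = \<zero>" using sq b by blast
      show "int (card (carrier R)) = 4 * 2" using card_carrier q m by simp
      fix r i :: int assume "r \<in> {0..4 - 1}" "i \<in> {0..2 - 1}" and zero: "r \<star> \<one> \<oplus> i \<star> b = \<zero>"
      then have ri: "r = 0 \<or> r = 1 \<or> r = 2 \<or> r = 3" "i = 0 \<or> i = 1" by auto
      have ib: "i \<star> b \<in> nonunits" using ri(2) b zero_nonunit by auto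
      have "1 \<star> \<one> \<oplus> i \<star> b \<noteq> \<zero>"
        using one_add_nonunit_neq_zero[OF Units_one_closed ib] by simp
      then have "r \<noteq> 1" using zero by metis
      moreover have "r \<noteq> 3"
        using zero one_add_nonunit_neq_zero[OF three_unit[OF q] ib] by metis
      moreover have "r \<noteq> 2"
      proof
        assume "r = 2"
        then have "2 \<star> \<one> \<oplus> i \<star> b = \<zero>" using zero by (simp only:)
        then have "2 \<star> \<one> = i \<star> b" using two_nonunit[OF q] ib by (rule add_eq_zero)
        moreover have "i \<star> b = \<zero> \<or> i \<star> b = b" using ri(2) b(1) by auto
        ultimately show False using b(2) False by (metis insertCI)
      qed
      ultimately have "r = 0" using ri(1) by blast
      moreover have "i \<noteq> 1"
      proof
        assume "i = 1"
        then have "b = \<zero>" using zero \<open>r = 0\<close> b(1) by simp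
        then show False using b(2) by simp
      qed
      ultimately show "r = 0 \<and> i = 0" using ri(2) by blast
    qed (use b finite_carrier in auto)
    then show ?thesis ..
  next
    case True
    obtain a where a: "a \<in> nonunits" "a \<notin> {\<zero>}" using m obtain_nonunit[of "{\<zero>}"] by auto
    obtain b where b: "b \<in> nonunits" "b \<notin> {\<zero>, a}"
      using m obtain_nonunit[of "{\<zero>, a}"] card_insert_le_m1[of 2 "{a}" "\<zero>"] by auto
    have "R \<simeq> idealization (residue_ring 2) (module_sum (residue_module 2) (residue_module 2))"
    proof (rule iso_idealization_residue_module_sum)
      show "a \<otimes> a = \<zero>" "b \<otimes> b = \<zero>" "a \<otimes> b = \<zero>" using sq a b by blast+
      show "int (card (carrier R)) = 2 * (2 * 2)" using card_carrier q m by simp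
      fix r i j :: int
      assume "r \<in> {0..2 - 1}" "i \<in> {0..2 - 1}" "j \<in> {0..2 - 1}"
        and zero: "r \<star> \<one> \<oplus> (i \<star> a \<oplus> j \<star> b) = \<zero>"
      then have rij: "r = 0 \<or> r = 1" "i = 0 \<or> i = 1" "j = 0 \<or> j = 1" by auto
      have ia: "i \<star> a \<in> nonunits" "j \<star> b \<in> nonunits" using rij a b zero_nonunit by auto
      then have "i \<star> a \<oplus> j \<star> b \<in> nonunits" by (rule nonunit_add)
      then have "1 \<star> \<one> \<oplus> (i \<star> a \<oplus> j \<star> b) \<noteq> \<zero>"
        using one_add_nonunit_neq_zero[OF Units_one_closed] by simp
      then have "r \<noteq> 1" using zero by metis
      then have "r = 0" using rij by blast
      then have "i \<star> a \<oplus> j \<star> b = \<zero>" using zero ia by simp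
      then have eq: "i \<star> a = j \<star> b" using ia by (rule add_eq_zero)
      have "i = 0"
      proof (rule ccontr)
        assume "i \<noteq> 0"
        then have "a = j \<star> b" using eq rij(2) a(1) by simp
        moreover have "j \<star> b = \<zero> \<or> j \<star> b = b" using rij(3) b(1) by auto
        ultimately show False using a(2) b(2) by (metis insertCI)
      qed
      moreover have "j = 0"
      proof (rule ccontr)
        assume "j \<noteq> 0"
        then have "b = \<zero>" using eq rij(3) b(1) \<open>i = 0\<close> by simp
        then show False using b(2) by simp
      qed
      ultimately show "r = 0 \<and> i = 0 \<and> j = 0" using \<open>r = 0\<close> by simp
    qed (use True a b finite_carrier in auto)
    then show ?thesis ..
  qed
qed

lemma nonzero_unit_if_maximal_card_1:
  assumes "maximal_card = 1" "x \<in> carrier R" "x \<noteq> \<zero>"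
  shows "x \<in> Units R"
proof -
  have "nonunits = {\<zero>}"
    using assms(1) zero_nonunit unfolding maximal_card_def by (metis card_1_singletonE singletonD)
  then show ?thesis using assms(2,3) by blast
qed

lemma integral_if_maximal_card_1:
  assumes "maximal_card = 1" "x \<in> carrier R" "y \<in> carrier R" "x \<otimes> y = \<zero>"
  shows "x = \<zero> \<or> y = \<zero>"
  using nonzero_unit_if_maximal_card_1[OF assms(1,2)] Units_l_cancel[of x y \<zero>] assms by auto

lemma iso_residue_ring_2:
  assumes "residue_card = 2" "maximal_card = 1"
  shows "R \<simeq> residue_ring 2"
proof -
  have "R \<simeq> residue_ring (int 2)"
  proof (rule iso_residue_ring)
    show "card (carrier R) = 2" using card_carrier assms by simp
    fix i :: int assume "0 < i" "i < int 2"
    then have "i = 1" by simp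
    then show "i \<star> \<one> \<noteq> \<zero>" using one_neq_zero by simp
  qed simp
  then show ?thesis by simp
qed

lemma iso_residue_ring_3:
  assumes "card (carrier R) = 3"
  shows "R \<simeq> residue_ring 3"
proof -
  have "R \<simeq> residue_ring (int 3)"
  proof (rule iso_residue_ring)
    fix i :: int assume "0 < i" "i < int 3"
    then have i: "i = 1 \<or> i = 2" by auto
    have "add_pow R (3::nat) \<one> = \<zero>" using order_add_pow_eq_zero[of \<one>] assms by simp
    then have "3 \<star> \<one> = \<zero>" by (simp add: add_pow_int_ge)
    moreover have "3 \<star> \<one> = \<one> \<oplus> 2 \<star> \<one>" using add.int_pow_mult[of \<one> 1 2] by simp
    ultimately show "i \<star> \<one> \<noteq> \<zero>" using i one_neq_zero by auto
  qed (use assms in auto)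
  then show ?thesis by simp
qed

text \<open>
  From \<open>(1 + 1)\<^sup>2 = 0\<close> the characteristic is 2. For \<open>w\<close> outside \<open>{0, 1}\<close> the elements are \<open>0, 1, w, 1 + w\<close>, and
  the absence of zero divisors leaves \<open>1 + w\<close> as the only possible value of \<open>w\<^sup>2\<close>.
\<close>

lemma iso_GF4_if_residue_card_4:
  assumes q: "residue_card = 4" and m: "maximal_card = 1"
  shows "R \<simeq> GF4"
proof -
  have card: "card (carrier R) = 4" using card_carrier q m by simp
  have "add_pow R (4::nat) \<one> = \<zero>" using order_add_pow_eq_zero[of \<one>] card by simp
  then have "4 \<star> \<one> = \<zero>" by (simp add: add_pow_int_ge)
  then have "(2 \<star> \<one>) \<otimes> (2 \<star> \<one>) = \<zero>" by (simp add: int_multiple_mult)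
  then have char: "2 \<star> \<one> = \<zero>" using integral_if_maximal_card_1[OF m, of "2 \<star> \<one>" "2 \<star> \<one>"] by simp
  \<comment> \<open>Multiplication by 2 vanishes on all of \<open>R\<close>, so \<open>x + y = 0\<close> means \<open>x = y\<close>.\<close>
  have add_self: "x \<oplus> x = \<zero>" if "x \<in> carrier R" for x
    using int_multiple_one_mult[OF that, of 2] char that two_multiple[OF that] by simp
  have add_eq_zero: "x = y" if "x \<oplus> y = \<zero>" "x \<in> carrier R" "y \<in> carrier R" for x y
  proof -
    have "x \<oplus> y = y \<oplus> y" using that add_self by simp
    then show ?thesis using that by simp
  qed
  have "\<not> carrier R \<subseteq> {\<zero>, \<one>}"
    using card card_mono[of "{\<zero>, \<one>}" "carrier R"] one_neq_zero by auto
  then obtain w where w: "w \<in> carrier R" "w \<noteq> \<zero>" "w \<noteq> \<one>" by blast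
  have nz: "\<one> \<oplus> w \<noteq> \<zero>" using add_eq_zero[of \<one> w] w by auto
  have "\<one> \<oplus> w \<noteq> \<one>" "\<one> \<oplus> w \<noteq> w" using w one_neq_zero by auto
  then have "card {\<zero>, \<one>, w, \<one> \<oplus> w} = 4" using w nz one_neq_zero by auto
  then have "carrier R = {\<zero>, \<one>, w, \<one> \<oplus> w}"
    using card card_subset_eq[OF finite_carrier, of "{\<zero>, \<one>, w, \<one> \<oplus> w}"] w by auto
  then have "w \<otimes> w \<in> {\<zero>, \<one>, w, \<one> \<oplus> w}" using w m_closed by blast
  moreover have "w \<otimes> w \<noteq> \<zero>" using integral_if_maximal_card_1[OF m w(1) w(1)] w(2) by blast
  moreover have "w \<otimes> w \<noteq> \<one>"
  proof
    assume "w \<otimes> w = \<one>"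
    then have "(\<one> \<oplus> w) \<otimes> (\<one> \<oplus> w) = (\<one> \<oplus> \<one>) \<oplus> (w \<oplus> w)"
      using w by (simp add: l_distr r_distr a_ac)
    then have "(\<one> \<oplus> w) \<otimes> (\<one> \<oplus> w) = \<zero>" using w add_self by simp
    then show False using integral_if_maximal_card_1[OF m, of "\<one> \<oplus> w" "\<one> \<oplus> w"] w nz by simp
  qed
  moreover have "w \<otimes> w \<noteq> w"
  proof
    assume "w \<otimes> w = w"
    then have "w \<otimes> (\<one> \<oplus> w) = \<zero>" using w add_self by (simp add: r_distr)
    then show False using integral_if_maximal_card_1[OF m, of w "\<one> \<oplus> w"] w nz by simp
  qed
  ultimately have "w \<otimes> w = \<one> \<oplus> w" by blast
  then show ?thesis using iso_GF4[OF char w(1) _ card] one_neq_zero w(2) nz by simp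
qed

end

section \<open>Values of zp on local rings\<close>

lemma card_carrier_eq_if_ring_iso: "R \<simeq> S \<Longrightarrow> card (carrier R) = card (carrier S)"
  unfolding is_ring_iso_def ring_iso_def by (auto dest: bij_betw_same_card)

context finite_local_ring begin

text \<open>
  A square-zero element carries over to \<open>R\<close> and shows that \<open>R\<close> is not a field. This separates the two rings
  of order 4 in the theorem from the field of order 4.
\<close>

lemma maximal_card_ge_2_if_ring_iso:
  assumes "R \<simeq> S" "ring S" "s \<in> carrier S" "s \<noteq> \<zero>\<^bsub>S\<^esub>" "s \<otimes>\<^bsub>S\<^esub> s = \<zero>\<^bsub>S\<^esub>"
  shows "maximal_card \<ge> 2"
proof (rule ccontr)
  assume "\<not> maximal_card \<ge> 2"
  then have m: "maximal_card = 1" using maximal_card_pos by simp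
  obtain h where "h \<in> ring_iso R S"
    using assms(1) unfolding is_ring_iso_def by (meson ex_in_conv)
  then have h: "h \<in> ring_hom R S" "bij_betw h (carrier R) (carrier S)"
    by (simp_all add: ring_iso_def)
  have "s \<in> h ` carrier R" using h(2) assms(3) by (simp add: bij_betw_def)
  then obtain x where x: "h x = s" "x \<in> carrier R" by (metis imageE)
  have zero: "h \<zero> = \<zero>\<^bsub>S\<^esub>" using ring_hom_zero[OF h(1) ring_axioms assms(2)] .
  have "h (x \<otimes> x) = h \<zero>" using ring_hom_mult[OF h(1)] x assms(5) zero by simp
  then have "x \<otimes> x = \<zero>" using h(2) x(2) inj_onD[of h "carrier R" "x \<otimes> x" \<zero>] by (simp add: bij_betw_def)
  then have "x = \<zero>" using integral_if_maximal_card_1[OF m x(2) x(2)] by blast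
  then show False using x(1) zero assms(4) by simp
qed

lemma zp_if_maximal_card_le_2:
  assumes "k \<ge> 2" "maximal_card \<le> 2"
  shows "zp k R = max_zp k residue_card maximal_card"
  using zp_eq_max_zp_iff[OF assms(1)] square_zero_if_maximal_card_le_2[OF assms(2)] by blast

text \<open>
  The case distinction behind every part of the theorem. The case \<open>small\<close> collects the pairs for which \<open>zp\<close>
  stays below \<open>max_zp k 2 4\<close>.
\<close>

lemma residue_maximal_card_cases:
  obtains (Z2) "residue_card = 2" "maximal_card = 1"
  | (order4) "residue_card = 2" "maximal_card = 2"
  | (order_ge_8) "residue_card = 2" "maximal_card \<ge> 4"
  | (Z3) "residue_card = 3" "maximal_card = 1"
  | (GF4) "residue_card = 4" "maximal_card = 1"
  | (small) "residue_card = 3 \<and> maximal_card \<ge> 2 \<or> residue_card = 4 \<and> maximal_card \<ge> 2 \<or> residue_card \<ge> 5"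
proof -
  have "\<not> (residue_card = 2 \<and> maximal_card = 3)"
    using three_not_dvd_card card_carrier by auto
  then consider "residue_card = 2" "maximal_card \<noteq> 3" | "residue_card = 3" | "residue_card = 4"
    | "residue_card \<ge> 5"
    using residue_card_ge_2 by linarith
  then show thesis
  proof cases
    case 1
    then consider "maximal_card = 1" | "maximal_card = 2" | "maximal_card \<ge> 4"
      using maximal_card_pos by linarith
    then show thesis using that(1-3)[OF 1(1)] by cases
  next
    case 2
    then show thesis using that(4,6) maximal_card_pos by (cases "maximal_card = 1") simp_all
  next
    case 3
    then show thesis using that(5,6) maximal_card_pos by (cases "maximal_card = 1") simp_all
  next
    case 4
    then show thesis using that(6) by simp
  qed
qed

text \<open>
  As 3 does not divide \<open>|R|\<close>, clearing denominators in \<open>zp k R = 1 - (2/3)\<^bsup>k\<^esup>\<close> makes 3 divide a power of 2 times a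
  power of \<open>|R|\<close>.
\<close>

lemma zp_neq_max_zp_3_1:
  assumes "residue_card = 2" "k \<ge> 1"
  shows "zp k R \<noteq> max_zp k 3 1"
proof
  let ?N = "card (carrier R)"
  define c where "c = card {x \<in> {1..k} \<rightarrow>\<^sub>E carrier R. (\<Otimes>i\<in>{1..k}. x i) = \<zero>}"
  assume "zp k R = max_zp k 3 1"
  then have "real c / real ?N ^ k = 1 - (2 / 3) ^ k"
    unfolding zp_def c_def max_zp_field by simp
  moreover have "real ?N \<noteq> 0" using card_carrier assms(1) maximal_card_pos by simp
  ultimately have "real c * 3 ^ k + 2 ^ k * real ?N ^ k = real ?N ^ k * 3 ^ k"
    by (simp add: field_simps)
  then have "real (c * 3 ^ k + 2 ^ k * ?N ^ k) = real (?N ^ k * 3 ^ k)" by simp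
  then have eq: "c * 3 ^ k + 2 ^ k * ?N ^ k = ?N ^ k * 3 ^ k" by (simp only: of_nat_eq_iff)
  have "(3::nat) dvd 3 ^ k" using assms(2) by simp
  then have "3 dvd c * 3 ^ k" "3 dvd ?N ^ k * 3 ^ k" by (rule dvd_mult)+
  then have "3 dvd 2 ^ k * ?N ^ k" using eq by (metis dvd_add_right_iff)
  moreover have "Factorial_Ring.prime (3::nat)" by simp
  ultimately have "(3::nat) dvd 2 \<or> 3 dvd ?N"
    by (metis prime_dvd_mult_nat prime_dvd_power_nat)
  then show False using three_not_dvd_card[OF assms(1)] by simp
qed

lemma zp_less_if_small:
  assumes "k \<ge> 2"
    and "residue_card = 3 \<and> maximal_card \<ge> 2 \<or> residue_card = 4 \<and> (maximal_card \<ge> 2 \<or> k \<ge> 3) \<or> residue_card \<ge> 5"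
  shows "zp k R < max_zp k 2 4"
  using zp_le_max_zp[of k] max_zp_small[OF assms(1) maximal_card_pos assms(2)] assms(1) by simp

text \<open>
  Monotonicity in \<open>m\<close> gives the bound. Equality with it forces both steps of the estimate to be equalities: \<open>m = 4\<close>
  and \<open>M\<^sup>2 = 0\<close>.
\<close>

lemma zp_if_order_ge_8:
  assumes "k \<ge> 2" "residue_card = 2" "maximal_card \<ge> 4"
  shows "zp k R \<le> max_zp k 2 4"
    and "zp k R = max_zp k 2 4 \<Longrightarrow>
           maximal_card = 4 \<and> (\<forall>x\<in>nonunits. \<forall>y\<in>nonunits. x \<otimes> y = \<zero>)"
proof -
  have le: "zp k R \<le> max_zp k 2 maximal_card" using zp_le_max_zp[of k] assms by simp
  then show "zp k R \<le> max_zp k 2 4"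
    using max_zp_antimono[of 2 k 4 maximal_card] assms by simp
  assume eq: "zp k R = max_zp k 2 4"
  then have "maximal_card = 4"
    using le max_zp_antimono_strict[of 2 k 4 maximal_card] assms by (cases "maximal_card = 4") auto
  then show "maximal_card = 4 \<and> (\<forall>x\<in>nonunits. \<forall>y\<in>nonunits. x \<otimes> y = \<zero>)"
    using eq zp_eq_max_zp_iff[OF assms(1)] assms(2) by simp
qed

lemma residue_card_3_if_card_3:
  assumes "card (carrier R) = 3"
  shows "residue_card = 3 \<and> maximal_card = 1"
proof -
  have prod: "residue_card * maximal_card = 3" using assms card_carrier by simp
  moreover have "Factorial_Ring.prime (3::nat)" by simp
  ultimately have "residue_card = 1 \<or> residue_card = 3"
    by (metis dvd_triv_left prime_nat_iff)
  then show ?thesis using prod residue_card_ge_2 by auto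
qed

lemma residue_card_2_if_card_4:
  assumes "card (carrier R) = 4" "maximal_card \<ge> 2"
  shows "residue_card = 2 \<and> maximal_card = 2"
proof -
  have prod: "residue_card * maximal_card = 4" using assms card_carrier by simp
  then have "residue_card * 2 \<le> 4" using assms(2) by (metis mult_le_mono2)
  then have "residue_card = 2" using residue_card_ge_2 by simp
  then show ?thesis using prod by simp
qed

end

theorem theorem4p2:
  fixes R :: "('a, 'b) ring_scheme" and k :: nat
  assumes "local_ring R" and "finite (carrier R)" and "k \<ge> 2"
  shows
    "(k = 2 \<or> k = 3 \<longrightarrow> zp k R \<notin> {zp_bound k 3 1 <..< zp_bound k 2 1}) \<and>
     (k \<ge> 4 \<longrightarrow> zp k R \<notin> {zp_bound k 2 2 <..< zp_bound k 2 1}) \<and>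
     (zp k R = zp_bound k 3 1 \<longleftrightarrow> R \<simeq> residue_ring 3) \<and>
     (zp k R = zp_bound k 2 2 \<longleftrightarrow>
        R \<simeq> residue_ring 4 \<or>
        R \<simeq> idealization (residue_ring 2) (residue_module 2)) \<and>
     (zp k R \<ge> zp_bound k 2 3 \<longrightarrow>
        (k = 2 \<longrightarrow>
           R \<simeq> residue_ring 2 \<or>
           R \<simeq> residue_ring 3 \<or>
           R \<simeq> residue_ring 4 \<or>
           R \<simeq> idealization (residue_ring 2) (residue_module 2) \<or>
           R \<simeq> idealization (residue_ring 4) (residue_module 2) \<or>
           R \<simeq> idealization (residue_ring 2) (module_sum (residue_module 2) (residue_module 2)) \<or>
           R \<simeq> GF4) \<and>
        (2 < k \<and> k < 6 \<longrightarrow>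
           R \<simeq> residue_ring 2 \<or>
           R \<simeq> residue_ring 3 \<or>
           R \<simeq> residue_ring 4 \<or>
           R \<simeq> idealization (residue_ring 2) (residue_module 2) \<or>
           R \<simeq> idealization (residue_ring 4) (residue_module 2) \<or>
           R \<simeq> idealization (residue_ring 2) (module_sum (residue_module 2) (residue_module 2))) \<and>
        (k \<ge> 6 \<longrightarrow>
           R \<simeq> residue_ring 2 \<or>
           R \<simeq> residue_ring 4 \<or>
           R \<simeq> idealization (residue_ring 2) (residue_module 2) \<or>
           R \<simeq> idealization (residue_ring 4) (residue_module 2) \<or>
           R \<simeq> idealization (residue_ring 2) (module_sum (residue_module 2) (residue_module 2))))"
proof -
  interpret finite_local_ring R
    using assms by (simp add: finite_local_ring_def finite_local_ring_axioms_def)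
  let ?B = "max_zp k 2" and ?T = "max_zp k 3 1"
  have k: "k \<ge> 1" using assms(3) by simp
  have bounds: "zp_bound k 2 1 = ?B 1" "zp_bound k 2 2 = ?B 2" "zp_bound k 2 3 = ?B 4" "zp_bound k 3 1 = ?T"
    using zp_bound_eq_max_zp[of 2 k 0] zp_bound_eq_max_zp[of 2 k 1] zp_bound_eq_max_zp[of 2 k 2]
      zp_bound_eq_max_zp[of 3 k 0] k
    by (simp_all add: numeral_eq_Suc)
  have B: "?B 2 < ?B 1" "?B 4 < ?B 2"
    using k max_zp_antimono_strict[of 2 k 1 2] max_zp_antimono_strict[of 2 k 2 4] by simp_all
  have T: "?T < ?B 1" using max_zp_3_1_less_2_1[OF k] .
  have exact: "maximal_card \<le> 2 \<Longrightarrow> zp k R = max_zp k residue_card maximal_card"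
    using zp_if_maximal_card_le_2[OF assms(3)] .
  have upper: "zp k R \<le> max_zp k residue_card maximal_card" using zp_le_max_zp[OF k] .
  have less_T: "zp k R < ?T" if "residue_card = 3 \<and> maximal_card \<ge> 2 \<or> residue_card \<ge> 4"
    using upper max_zp_less_3_1[OF k maximal_card_pos that] by simp
  have gap_small: "zp k R \<notin> {?T <..< ?B 1}" if "k = 2 \<or> k = 3"
  proof -
    have "zp k R \<le> ?T \<or> zp k R = ?B 1"
    proof (cases rule: residue_maximal_card_cases)
      case Z2
      then show ?thesis using exact by simp
    next
      case order4
      then show ?thesis using exact max_zp_2_2_le_3_1[OF that] by simp
    next
      case order_ge_8
      then show ?thesis using zp_if_order_ge_8(1)[OF assms(3)] max_zp_2_2_le_3_1[OF that] B by simp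
    next
      case Z3
      then show ?thesis using exact by simp
    next
      case GF4
      then have "zp k R < ?T" by (intro less_T) simp
      then show ?thesis by simp
    next
      case small
      then have "zp k R < ?T" by (intro less_T) auto
      then show ?thesis by simp
    qed
    then show ?thesis by auto
  qed
  have gap_large: "zp k R \<notin> {?B 2 <..< ?B 1}" if "k \<ge> 4"
  proof -
    have TB: "?T < ?B 2" using max_zp_3_1_less_2_2[OF that] .
    have "zp k R \<le> ?B 2 \<or> zp k R = ?B 1"
    proof (cases rule: residue_maximal_card_cases)
      case Z2
      then show ?thesis using exact by simp
    next
      case order4
      then show ?thesis using exact by simp
    next
      case order_ge_8
      then show ?thesis using zp_if_order_ge_8(1)[OF assms(3)] B by simp
    next
      case Z3
      then show ?thesis using exact TB by simp
    next
      case GF4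
      then have "zp k R < ?T" by (intro less_T) simp
      then show ?thesis using TB by simp
    next
      case small
      then have "zp k R < ?T" by (intro less_T) auto
      then show ?thesis using TB by simp
    qed
    then show ?thesis by auto
  qed
  have T_iff: "zp k R = ?T \<longleftrightarrow> R \<simeq> residue_ring 3"
  proof
    assume eq: "zp k R = ?T"
    show "R \<simeq> residue_ring 3"
    proof (cases rule: residue_maximal_card_cases)
      case Z3
      then show ?thesis using iso_residue_ring_3 card_carrier by simp
    next
      case GF4
      then have "zp k R < ?T" by (intro less_T) simp
      then show ?thesis using eq by simp
    next
      case small
      then have "zp k R < ?T" by (intro less_T) auto
      then show ?thesis using eq by simp
    qed (use eq zp_neq_max_zp_3_1[OF _ k] in blast)+
  next
    assume "R \<simeq> residue_ring 3"
    then have "card (carrier R) = 3"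
      using card_carrier_eq_if_ring_iso[of R "residue_ring 3"] by (simp add: residue_ring_def)
    then show "zp k R = ?T" using residue_card_3_if_card_3 exact by simp
  qed
  have B2_iff: "zp k R = ?B 2 \<longleftrightarrow>
      R \<simeq> residue_ring 4 \<or> R \<simeq> idealization (residue_ring 2) (residue_module 2)"
  proof
    assume eq: "zp k R = ?B 2"
    show "R \<simeq> residue_ring 4 \<or> R \<simeq> idealization (residue_ring 2) (residue_module 2)"
    proof (cases rule: residue_maximal_card_cases)
      case Z2
      then show ?thesis using eq exact B by simp
    next
      case order4
      then show ?thesis by (rule iso_maximal_card_2)
    next
      case order_ge_8
      then show ?thesis using eq zp_if_order_ge_8(1)[OF assms(3)] B by simp
    next
      case Z3
      then show ?thesis using eq exact max_zp_3_1_neq_2_2[OF k] by simp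
    next
      case GF4
      show ?thesis
      proof (cases "k \<ge> 3")
        case True
        then show ?thesis using zp_less_if_small[OF assms(3)] GF4 eq B by simp
      next
        case False
        then have "k = 2" using assms(3) by simp
        moreover have "max_zp 2 4 1 \<noteq> max_zp 2 2 2" by (simp add: max_zp_def power2_eq_square)
        ultimately show ?thesis using eq exact GF4 by simp
      qed
    next
      case small
      then have "zp k R < ?B 4" by (intro zp_less_if_small[OF assms(3)]) auto
      then show ?thesis using eq B by simp
    qed
  next
    assume iso: "R \<simeq> residue_ring 4 \<or> R \<simeq> idealization (residue_ring 2) (residue_module 2)"
    have "card (carrier R) = 4 \<and> maximal_card \<ge> 2"
      using iso
    proof
      assume R: "R \<simeq> residue_ring 4"
      have "maximal_card \<ge> 2"
        by (rule maximal_card_ge_2_if_ring_iso[OF R ring_residue_ring, of 2])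
           (simp_all add: residue_ring_def)
      then show ?thesis using card_carrier_eq_if_ring_iso[OF R] by (simp add: residue_ring_def)
    next
      let ?S = "idealization (residue_ring 2) (residue_module 2)"
      assume R: "R \<simeq> ?S"
      have "ring ?S"
        using cring_idealization[OF module_residue_module[of 2 2]] by (simp add: cring.axioms(1))
      then have "maximal_card \<ge> 2"
        by (rule maximal_card_ge_2_if_ring_iso[OF R, of "(0, 1)"])
           (simp_all add: idealization_def residue_ring_def residue_module_def)
      then show ?thesis using card_carrier_eq_if_ring_iso[OF R]
        by (simp add: idealization_def residue_ring_def residue_module_def)
    qed
    then show "zp k R = ?B 2" using residue_card_2_if_card_4 exact by simp
  qed
  have list: "residue_card = 2 \<and> maximal_card = 1 \<or> residue_card = 2 \<and> maximal_card = 2 \<or>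
      R \<simeq> idealization (residue_ring 4) (residue_module 2) \<or>
      R \<simeq> idealization (residue_ring 2) (module_sum (residue_module 2) (residue_module 2)) \<or>
      residue_card = 3 \<and> maximal_card = 1 \<and> k < 6 \<or>
      residue_card = 4 \<and> maximal_card = 1 \<and> k = 2"
    if large: "zp k R \<ge> ?B 4"
  proof (cases rule: residue_maximal_card_cases)
    case order_ge_8
    then have "zp k R = ?B 4" using large zp_if_order_ge_8(1)[OF assms(3)] by simp
    then show ?thesis using iso_maximal_card_4 order_ge_8 zp_if_order_ge_8(2)[OF assms(3)] by blast
  next
    case Z3
    have "\<not> k \<ge> 6" using large exact Z3 max_zp_3_1_less[of k] by auto
    then show ?thesis using Z3 by simp
  next
    case GF4
    have "\<not> k \<ge> 3" using large GF4 zp_less_if_small[OF assms(3)] by auto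
    then show ?thesis using GF4 assms(3) by simp
  next
    case small
    then have "zp k R < ?B 4" by (intro zp_less_if_small[OF assms(3)]) auto
    then show ?thesis using large by simp
  next
    case Z2
    then show ?thesis by blast
  next
    case order4
    then show ?thesis by blast
  qed
  have iso_Z2: "R \<simeq> residue_ring 2" if "residue_card = 2 \<and> maximal_card = 1"
    using that by (intro iso_residue_ring_2) simp_all
  have iso_order4: "R \<simeq> residue_ring 4 \<or> R \<simeq> idealization (residue_ring 2) (residue_module 2)"
    if "residue_card = 2 \<and> maximal_card = 2"
    using that by (intro iso_maximal_card_2) simp_all
  have iso_Z3: "R \<simeq> residue_ring 3" if "residue_card = 3 \<and> maximal_card = 1"
    using that card_carrier by (intro iso_residue_ring_3) simp
  have iso_F4: "R \<simeq> GF4" if "residue_card = 4 \<and> maximal_card = 1"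
    using that by (intro iso_GF4_if_residue_card_4) simp_all
  have rings: "R \<simeq> residue_ring 2 \<or> R \<simeq> residue_ring 4 \<or>
      R \<simeq> idealization (residue_ring 2) (residue_module 2) \<or>
      R \<simeq> idealization (residue_ring 4) (residue_module 2) \<or>
      R \<simeq> idealization (residue_ring 2) (module_sum (residue_module 2) (residue_module 2)) \<or>
      R \<simeq> residue_ring 3 \<and> k < 6 \<or> R \<simeq> GF4 \<and> k = 2"
    if "zp k R \<ge> ?B 4"
    using list[OF that] iso_Z2 iso_order4 iso_Z3 iso_F4 by blast
  show ?thesis
    unfolding bounds
  proof (intro conjI impI, goal_cases)
    case 1 then show ?case by (rule gap_small)
  next
    case 2 then show ?case by (rule gap_large)
  next
    case 3 show ?case by (rule T_iff)
  next
    case 4 show ?case by (rule B2_iff)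
  next
    case 5 then show ?case using rings by blast
  next
    case 6
    then have "k \<noteq> 2" by simp
    then show ?case using rings[OF 6(1)] by blast
  next
    case 7
    then have "k \<noteq> 2" "\<not> k < 6" by simp_all
    then show ?case using rings[OF 7(1)] by blast
  qed
qed

end
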